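(* Let $\mathcal M$ be an o-minimal structure and let $G$ be a group definable in $\mathcal M$ of dimension $1$. Then $G$ is cohesive.
   Context: "Definable" means definable in $\mathcal M$ with parameters. A box for definable sets $Y_1,\ldots,Y_n$ is a definable set $U_1\times\cdots\times U_n$ with $U_i\subseteq Y_i$. Definable sets $X_1,\ldots,X_n$ are orthogonal if for all $k_1,\ldots,k_n\in\mathbb N$ every definable subset of $X_1^{k_1}\times\cdots\times X_n^{k_n}$ is a finite union of $(X_1^{k_1},\ldots,X_n^{k_n})$-boxes. A definable set $Z$ is cohesive if whenever two definable sets $X$ and $Y$ are both non-orthogonal to $Z$, then $X$ and $Y$ are non-orthogonal to each other. *)

theory Defs
  imports "HOL-Algebra.Group"
begin

section \<open>First-order structures expanding a linear order\<close>

datatype 'f trm = Var nat | App 'f "'f trm list"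

text \<open>Variables are de Bruijn indices; \<open>Ex\<close> binds index \<open>0\<close>. The order is always part of the
  language, through the atomic formulas \<open>Less\<close>.\<close>

datatype ('f, 'r) fm =
    Eq "'f trm" "'f trm"
  | Less "'f trm" "'f trm"
  | Rel 'r "'f trm list"
  | Neg "('f, 'r) fm"
  | Conj "('f, 'r) fm" "('f, 'r) fm"
  | Ex "('f, 'r) fm"

text \<open>The universe is the whole type \<open>'a\<close>, whose order interprets \<open>Less\<close>. The remaining signature
  consists of the pairs (symbol, arity) in \<open>fsyms\<close> and \<open>rsyms\<close>, either of which may be empty.
  Only the values of \<open>fint\<close> and \<open>rint\<close> on declared symbols and on lists of the declared
  length matter.\<close>

record ('f, 'r, 'a) fo_structure =
  fsyms :: "('f \<times> nat) set"
  rsyms :: "('r \<times> nat) set"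
  fint :: "'f \<Rightarrow> 'a list \<Rightarrow> 'a"
  rint :: "'r \<Rightarrow> 'a list \<Rightarrow> bool"

primrec wf_trm :: "('f, 'r, 'a) fo_structure \<Rightarrow> 'f trm \<Rightarrow> bool" where
  "wf_trm M (Var i) \<longleftrightarrow> True"
| "wf_trm M (App f ts) \<longleftrightarrow> (f, length ts) \<in> fsyms M \<and> list_all id (map (wf_trm M) ts)"

primrec wf_fm :: "('f, 'r, 'a) fo_structure \<Rightarrow> ('f, 'r) fm \<Rightarrow> bool" where
  "wf_fm M (Eq s t) \<longleftrightarrow> wf_trm M s \<and> wf_trm M t"
| "wf_fm M (Less s t) \<longleftrightarrow> wf_trm M s \<and> wf_trm M t"
| "wf_fm M (Rel r ts) \<longleftrightarrow> (r, length ts) \<in> rsyms M \<and> list_all (wf_trm M) ts"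
| "wf_fm M (Neg p) \<longleftrightarrow> wf_fm M p"
| "wf_fm M (Conj p q) \<longleftrightarrow> wf_fm M p \<and> wf_fm M q"
| "wf_fm M (Ex p) \<longleftrightarrow> wf_fm M p"

primrec eval_trm :: "('f, 'r, 'a) fo_structure \<Rightarrow> (nat \<Rightarrow> 'a) \<Rightarrow> 'f trm \<Rightarrow> 'a" where
  "eval_trm M e (Var i) = e i"
| "eval_trm M e (App f ts) = fint M f (map (eval_trm M e) ts)"

primrec sat :: "('f, 'r, 'a::linorder) fo_structure \<Rightarrow> (nat \<Rightarrow> 'a) \<Rightarrow> ('f, 'r) fm \<Rightarrow> bool" where
  "sat M e (Eq s t) \<longleftrightarrow> eval_trm M e s = eval_trm M e t"
| "sat M e (Less s t) \<longleftrightarrow> eval_trm M e s < eval_trm M e t"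
| "sat M e (Rel r ts) \<longleftrightarrow> rint M r (map (eval_trm M e) ts)"
| "sat M e (Neg p) \<longleftrightarrow> \<not> sat M e p"
| "sat M e (Conj p q) \<longleftrightarrow> sat M e p \<and> sat M e q"
| "sat M e (Ex p) \<longleftrightarrow> (\<exists>x. sat M (case_nat x e) p)"

section \<open>Definable sets\<close>

text \<open>A subset of the \<open>n\<close>-th power of \<open>M\<close> is a set of lists of length \<open>n\<close>. In a defining formula
  the first \<open>n\<close> variables stand for the point, and the others are assigned the parameters
  \<open>c 0, c 1, \<dots>\<close>, of which only finitely many can occur.\<close>

definition definable_dim :: "('f, 'r, 'a::linorder) fo_structure \<Rightarrow> nat \<Rightarrow> 'a list set \<Rightarrow> bool" where
  "definable_dim M n X \<longleftrightarrow>
    (\<exists>p c. wf_fm M p \<and>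
      X = {xs. length xs = n \<and> sat M (\<lambda>i. if i < n then xs ! i else c (i - n)) p})"

definition definable :: "('f, 'r, 'a::linorder) fo_structure \<Rightarrow> 'a list set \<Rightarrow> bool" where
  "definable M X \<longleftrightarrow> (\<exists>n. definable_dim M n X)"

definition point_or_interval :: "'a::linorder set \<Rightarrow> bool" where
  "point_or_interval I \<longleftrightarrow>
    (\<exists>a. I = {a}) \<or> (\<exists>a b. I = {a<..<b}) \<or> (\<exists>a. I = {a<..}) \<or> (\<exists>a. I = {..<a}) \<or> I = UNIV"

text \<open>The underlying order is dense without endpoints, by the type class.\<close>

definition o_minimal :: "('f, 'r, 'a::unbounded_dense_linorder) fo_structure \<Rightarrow> bool" where
  "o_minimal M \<longleftrightarrow>
    (\<forall>X. definable_dim M 1 X \<longrightarrow>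
      (\<exists>\<C>. finite \<C> \<and> (\<forall>I\<in>\<C>. point_or_interval I) \<and> {x. [x] \<in> X} = \<Union>\<C>))"

text \<open>The dimension of a nonempty definable set is the largest \<open>k\<close> such that its projection onto
  some \<open>k\<close> coordinates contains an open box. No convention is made for the empty set.\<close>

definition open_box :: "'a::linorder list \<Rightarrow> 'a list \<Rightarrow> 'a list set" where
  "open_box as bs = {xs. list_all2 (<) as xs \<and> list_all2 (<) xs bs}"

definition contains_open_box :: "nat \<Rightarrow> 'a::linorder list set \<Rightarrow> bool" where
  "contains_open_box k P \<longleftrightarrow>
    (\<exists>as bs. length as = k \<and> list_all2 (<) as bs \<and> open_box as bs \<subseteq> P)"

definition odim :: "'a::linorder list set \<Rightarrow> nat" where
  "odim X = Max {k. \<exists>J. contains_open_box k ((\<lambda>xs. nths xs J) ` X)}"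

definition definable_group ::
    "('f, 'r, 'a::linorder) fo_structure \<Rightarrow> ('a list, 'm) monoid_scheme \<Rightarrow> bool" where
  "definable_group M G \<longleftrightarrow>
    group G \<and> definable M (carrier G) \<and>
    definable M {x @ y @ (x \<otimes>\<^bsub>G\<^esub> y) | x y. x \<in> carrier G \<and> y \<in> carrier G}"

section \<open>Orthogonality and cohesiveness\<close>

text \<open>Products are formed by concatenating the lists; for definable factors the lists in each
  factor have a common length, so the decomposition of a point is unique.\<close>

definition cart_prod :: "'a list set list \<Rightarrow> 'a list set" where
  "cart_prod Xs = concat ` listset Xs"

definition cart_power :: "'a list set \<Rightarrow> nat \<Rightarrow> 'a list set" where
  "cart_power X k = cart_prod (replicate k X)"

definition box_for ::
    "('f, 'r, 'a::linorder) fo_structure \<Rightarrow> 'a list set list \<Rightarrow> 'a list set \<Rightarrow> bool" where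
  "box_for M Ys B \<longleftrightarrow>
    (\<exists>Us. list_all2 (\<lambda>U Y. definable M U \<and> U \<subseteq> Y) Us Ys \<and> B = cart_prod Us)"

definition orthogonal :: "('f, 'r, 'a::linorder) fo_structure \<Rightarrow> 'a list set list \<Rightarrow> bool" where
  "orthogonal M Xs \<longleftrightarrow>
    (\<forall>ks D. length ks = length Xs \<longrightarrow> definable M D \<longrightarrow>
      D \<subseteq> cart_prod (map2 cart_power Xs ks) \<longrightarrow>
      (\<exists>\<B>. finite \<B> \<and> (\<forall>B\<in>\<B>. box_for M (map2 cart_power Xs ks) B) \<and> D = \<Union>\<B>))"

definition cohesive :: "('f, 'r, 'a::linorder) fo_structure \<Rightarrow> 'a list set \<Rightarrow> bool" where
  "cohesive M Z \<longleftrightarrow>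
    definable M Z \<and>
    (\<forall>X Y. definable M X \<longrightarrow> definable M Y \<longrightarrow>
      \<not> orthogonal M [X, Z] \<longrightarrow> \<not> orthogonal M [Y, Z] \<longrightarrow> \<not> orthogonal M [X, Y])"

end

theory Submission imports Defs
begin

text \<open>Two definable sets are non-orthogonal iff some definable family of subsets of a power of one,
  indexed by a power of the other, has infinitely many members. From such a family one extracts,
  by taking the least boundary point of a member in a suitable interval, a definable partial
  function from a power of \<open>X\<close> to the line whose infinite image consists of coordinates of points of
  \<open>Z\<close>. Non-orthogonality of \<open>X\<close> and of \<open>Y\<close> to \<open>G\<close> thus yields infinite sets \<open>I\<close> and \<open>J\<close> of
  coordinates on \<open>G\<close>. Since \<open>G\<close> has dimension 1, coordinates are finite-to-one up to finitely many
  values, and the same dimension count gives a translation of \<open>G\<close> that moves infinitely many points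
  over \<open>J\<close> to points over \<open>I\<close>. The resulting finite-to-finite correspondence between \<open>I\<close> and \<open>J\<close>,
  pulled back to powers of \<open>X\<close> and \<open>Y\<close>, has infinitely many sections.

  The dimension count only needs that a definable subset of the plane with infinitely many infinite
  fibres contains a box; this is proved directly from o-minimality on the line, without cell
  decomposition or the monotonicity theorem.\<close>

section \<open>Definable predicates\<close>

primrec ren_trm :: "(nat \<Rightarrow> nat) \<Rightarrow> 'f trm \<Rightarrow> 'f trm" where
  "ren_trm f (Var i) = Var (f i)"
| "ren_trm f (App g ts) = App g (map (ren_trm f) ts)"

primrec ren_fm :: "(nat \<Rightarrow> nat) \<Rightarrow> ('f, 'r) fm \<Rightarrow> ('f, 'r) fm" where
  "ren_fm f (Eq s t) = Eq (ren_trm f s) (ren_trm f t)"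
| "ren_fm f (Less s t) = Less (ren_trm f s) (ren_trm f t)"
| "ren_fm f (Rel r ts) = Rel r (map (ren_trm f) ts)"
| "ren_fm f (Neg p) = Neg (ren_fm f p)"
| "ren_fm f (Conj p q) = Conj (ren_fm f p) (ren_fm f q)"
| "ren_fm f (Ex p) = Ex (ren_fm (case_nat 0 (\<lambda>i. Suc (f i))) p)"

lemma eval_ren_trm [simp]: "eval_trm M e (ren_trm f t) = eval_trm M (\<lambda>i. e (f i)) t"
  by (induction t) (auto simp: comp_def cong: map_cong)

lemma wf_ren_trm [simp]: "wf_trm M (ren_trm f t) = wf_trm M t"
  by (induction t) (auto simp: list_all_iff)

lemma sat_ren_fm [simp]: "sat M e (ren_fm f p) = sat M (\<lambda>i. e (f i)) p"
proof (induction p arbitrary: e f)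
  case (Ex p)
  have "(\<lambda>i. case_nat x e (case_nat 0 (\<lambda>i. Suc (f i)) i)) = case_nat x (\<lambda>i. e (f i))" for x
    by (auto split: nat.splits)
  then show ?case using Ex by simp
qed (simp_all add: comp_def)

lemma wf_ren_fm [simp]: "wf_fm M (ren_fm f p) = wf_fm M p"
  by (induction p arbitrary: f) (auto simp: list_all_iff)

text \<open>Definability is handled on predicates of an assignment \<open>e\<close> rather than on formulas: the atoms
  are coordinates of \<open>e\<close> and parameters, and a bound variable takes index 0, shifting the others.\<close>

definition dterm :: "((nat \<Rightarrow> 'a) \<Rightarrow> 'a) \<Rightarrow> bool" where
  "dterm t \<longleftrightarrow> (\<exists>i. t = (\<lambda>e. e i)) \<or> (\<exists>c. t = (\<lambda>e. c))"

definition dlist :: "((nat \<Rightarrow> 'a) \<Rightarrow> 'a list) \<Rightarrow> bool" where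
  "dlist t \<longleftrightarrow> (\<exists>ts. (\<forall>f\<in>set ts. dterm f) \<and> t = (\<lambda>e. map (\<lambda>f. f e) ts))"

text \<open>The variables of the formula may read coordinates and parameters in any order and with
  repetitions, which makes closure under substitution immediate. The rigid layout of
  \<open>definable_dim\<close> is recovered in \<open>definable_dimI\<close>.\<close>

definition dpred :: "('f, 'r, 'a::linorder) fo_structure \<Rightarrow> ((nat \<Rightarrow> 'a) \<Rightarrow> bool) \<Rightarrow> bool" where
  "dpred M P \<longleftrightarrow>
    (\<exists>p s. wf_fm M p \<and> (\<forall>i. dterm (s i)) \<and> (\<forall>e. P e \<longleftrightarrow> sat M (\<lambda>i. s i e) p))"

lemma dterm_var: "dterm (\<lambda>e. e i)" and dterm_const: "dterm (\<lambda>e. c)"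
  by (auto simp: dterm_def)

lemma dterm_subst: "dterm t \<Longrightarrow> (\<And>i. dterm (s i)) \<Longrightarrow> dterm (\<lambda>e. t (\<lambda>i. s i e))"
  by (auto simp: dterm_def)

lemma dlistI: "(\<And>f. f \<in> set ts \<Longrightarrow> dterm f) \<Longrightarrow> dlist (\<lambda>e. map (\<lambda>f. f e) ts)"
  unfolding dlist_def by blast

lemma dlist_Nil: "dlist (\<lambda>e. [])"
  using dlistI[of "[]"] by simp

lemma dlist_Cons:
  assumes "dterm t" "dlist u"
  shows "dlist (\<lambda>e. t e # u e)"
proof -
  obtain ts where "\<forall>f\<in>set ts. dterm f" "u = (\<lambda>e. map (\<lambda>f. f e) ts)"
    using assms(2) by (auto simp: dlist_def)
  then show ?thesis using assms(1) unfolding dlist_def by (intro exI[of _ "t # ts"]) auto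
qed

lemma dlist_append:
  assumes "dlist t" "dlist u"
  shows "dlist (\<lambda>e. t e @ u e)"
proof -
  obtain ts us where "\<forall>f\<in>set ts. dterm f" "t = (\<lambda>e. map (\<lambda>f. f e) ts)"
    "\<forall>f\<in>set us. dterm f" "u = (\<lambda>e. map (\<lambda>f. f e) us)"
    using assms by (auto simp: dlist_def)
  then show ?thesis unfolding dlist_def by (intro exI[of _ "ts @ us"]) auto
qed

lemma dlist_take: "dlist t \<Longrightarrow> dlist (\<lambda>e. take n (t e))"
proof -
  assume "dlist t"
  then obtain ts where "\<forall>f\<in>set ts. dterm f" "t = (\<lambda>e. map (\<lambda>f. f e) ts)"
    unfolding dlist_def by blast
  then show ?thesis
    using dlistI[of "take n ts"] by (auto simp: take_map dest: in_set_takeD)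
qed

lemma dlist_drop: "dlist t \<Longrightarrow> dlist (\<lambda>e. drop n (t e))"
proof -
  assume "dlist t"
  then obtain ts where "\<forall>f\<in>set ts. dterm f" "t = (\<lambda>e. map (\<lambda>f. f e) ts)"
    unfolding dlist_def by blast
  then show ?thesis
    using dlistI[of "drop n ts"] by (auto simp: drop_map dest: in_set_dropD)
qed

lemma dlist_const: "dlist (\<lambda>e. c)"
  by (induction c) (auto intro: dlist_Nil dlist_Cons dterm_const)

lemma dlist_vars: "dlist (\<lambda>e. map (\<lambda>i. e (f i)) xs)"
  by (induction xs) (auto intro: dlist_Nil dlist_Cons dterm_var)

lemma dterm_nth:
  assumes "dlist t"
  shows "dterm (\<lambda>e. t e ! i)"
proof -
  have "\<forall>f\<in>set ts. dterm f \<Longrightarrow> dterm (\<lambda>e. map (\<lambda>f. f e) ts ! i)"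
    for ts :: "((nat \<Rightarrow> 'a) \<Rightarrow> 'a) list"
  proof (induction ts arbitrary: i)
    case Nil
    show ?case by (auto simp: dterm_def)
  next
    case (Cons t ts)
    then show ?case by (cases i) auto
  qed
  then show ?thesis using assms by (auto simp: dlist_def)
qed

section \<open>Closure of definable predicates under connectives, quantifiers and
  substitution\<close>

lemma dpred_neg: "dpred M P \<Longrightarrow> dpred M (\<lambda>e. \<not> P e)"
  unfolding dpred_def by (metis sat.simps(4) wf_fm.simps(4))

lemma dpred_conj:
  assumes "dpred M P" "dpred M Q"
  shows "dpred M (\<lambda>e. P e \<and> Q e)"
proof -
  obtain p s q t where p: "wf_fm M p" "\<And>i. dterm (s i)" "\<And>e. P e \<longleftrightarrow> sat M (\<lambda>i. s i e) p"
    and q: "wf_fm M q" "\<And>i. dterm (t i)" "\<And>e. Q e \<longleftrightarrow> sat M (\<lambda>i. t i e) q"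
    using assms unfolding dpred_def by metis
  \<comment> \<open>The two formulas come with unrelated assignments, so their variables are moved
    to even and odd indices before sharing one assignment.\<close>
  let ?r = "Conj (ren_fm (\<lambda>i. 2 * i) p) (ren_fm (\<lambda>i. Suc (2 * i)) q)"
  let ?u = "\<lambda>i. if even i then s (i div 2) else t (i div 2)"
  show ?thesis unfolding dpred_def
    by (rule exI[of _ ?r], rule exI[of _ ?u]) (use p q in simp)
qed

lemma dpred_disj: "dpred M P \<Longrightarrow> dpred M Q \<Longrightarrow> dpred M (\<lambda>e. P e \<or> Q e)"
  using dpred_neg[OF dpred_conj[OF dpred_neg dpred_neg]] by fastforce

lemma dpred_imp: "dpred M P \<Longrightarrow> dpred M Q \<Longrightarrow> dpred M (\<lambda>e. P e \<longrightarrow> Q e)"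
  using dpred_disj[OF dpred_neg] by fastforce

lemma dpred_iff: "dpred M P \<Longrightarrow> dpred M Q \<Longrightarrow> dpred M (\<lambda>e. P e = Q e)"
  using dpred_conj[OF dpred_imp[of M P Q] dpred_imp[of M Q P]] by (simp add: iff_conv_conj_imp)

lemma dpred_less:
  assumes "dterm t" "dterm u"
  shows "dpred M (\<lambda>e. t e < u e)"
  unfolding dpred_def
  by (rule exI[of _ "Less (Var 0) (Var 1)"], rule exI[of _ "case_nat t (\<lambda>_. u)"])
    (use assms in \<open>auto split: nat.splits\<close>)

lemma dpred_eq:
  assumes "dterm t" "dterm u"
  shows "dpred M (\<lambda>e. t e = u e)"
  unfolding dpred_def
  by (rule exI[of _ "Eq (Var 0) (Var 1)"], rule exI[of _ "case_nat t (\<lambda>_. u)"])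
    (use assms in \<open>auto split: nat.splits\<close>)

lemma dpred_le: "dterm t \<Longrightarrow> dterm u \<Longrightarrow> dpred M (\<lambda>e. t e \<le> u e)"
  using dpred_neg[OF dpred_less[of u t]] by (simp add: not_less)

lemma dpred_subst:
  assumes "dpred M P" "\<And>i. dterm (t i)"
  shows "dpred M (\<lambda>e. P (\<lambda>i. t i e))"
proof -
  obtain p s where p: "wf_fm M p" "\<And>i. dterm (s i)" "\<And>e. P e \<longleftrightarrow> sat M (\<lambda>i. s i e) p"
    using assms(1) unfolding dpred_def by metis
  then show ?thesis unfolding dpred_def
    by (intro exI[of _ p] exI[of _ "\<lambda>i e. s i (\<lambda>j. t j e)"]) (auto intro: dterm_subst assms(2))
qed

lemma dpred_const: "dpred M (\<lambda>e. b)"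
proof (cases b)
  case True
  then show ?thesis using dpred_eq[OF dterm_var dterm_var, of M 0 0] by simp
next
  case False
  then show ?thesis using dpred_less[OF dterm_var dterm_var, of M 0 0] by simp
qed

lemma dpred_ex:
  fixes M :: "('f, 'r, 'a::linorder) fo_structure"
  assumes "dpred M (\<lambda>e. Q (\<lambda>i. e (Suc i)) (e 0))"
  shows "dpred M (\<lambda>e. \<exists>x. Q e x)"
proof -
  obtain p s where p: "wf_fm M p" "\<And>i. dterm (s i)"
    "\<And>e. Q (\<lambda>i. e (Suc i)) (e 0) \<longleftrightarrow> sat M (\<lambda>i. s i e) p"
    using assms unfolding dpred_def by metis
  \<comment> \<open>Every index whose term reads the bound coordinate is merged into 0, and all
    others are shifted. The value \<open>undefined\<close> then only stands at indices that the
    renamed formula never reads.\<close>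
  let ?f = "\<lambda>i. if s i = (\<lambda>e. e 0) then 0 else Suc i"
  let ?s = "\<lambda>i e. s i (case_nat undefined e)"
  have "s i (case_nat x e) = case_nat x (\<lambda>i. ?s i e) (?f i)" for i x e
    using p(2)[of i] by (auto simp: dterm_def split: nat.splits)
  then have env: "(\<lambda>i. s i (case_nat x e)) = (\<lambda>i. case_nat x (\<lambda>i. ?s i e) (?f i))" for x e
    by (intro ext)
  have body: "Q e x \<longleftrightarrow> sat M (case_nat x (\<lambda>i. ?s i e)) (ren_fm ?f p)" for e x
    using p(3)[of "case_nat x e"] unfolding sat_ren_fm env[of x e, symmetric] by simp
  have "dterm (\<lambda>e :: nat \<Rightarrow> 'a. case_nat undefined e j)" for j
    by (cases j) (simp_all add: dterm_const dterm_var)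
  then have "dterm (?s i)" for i
    using dterm_subst[OF p(2)[of i], of "\<lambda>j e. case_nat undefined e j"] by simp
  moreover have "(\<exists>x. Q e x) \<longleftrightarrow> sat M (\<lambda>i. ?s i e) (Ex (ren_fm ?f p))" for e
    by (simp only: sat.simps body)
  moreover have "wf_fm M (Ex (ren_fm ?f p))" using p(1) by simp
  ultimately show ?thesis unfolding dpred_def
    by (intro exI[of _ "Ex (ren_fm ?f p)"] exI[of _ ?s]) (intro conjI allI)
qed

lemma dpred_all:
  assumes "dpred M (\<lambda>e. Q (\<lambda>i. e (Suc i)) (e 0))"
  shows "dpred M (\<lambda>e. \<forall>x. Q e x)"
  using dpred_neg[OF dpred_ex[of M "\<lambda>e x. \<not> Q e x"]] dpred_neg[OF assms] by simp

lemma dpred_ex_list: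
  assumes "dpred M (\<lambda>e. Q (\<lambda>i. e (i + n)) (map e [0..<n]))"
  shows "dpred M (\<lambda>e. \<exists>x. length x = n \<and> Q e x)"
  using assms
proof (induction n arbitrary: Q)
  case 0
  then show ?case by simp
next
  case (Suc n)
  \<comment> \<open>The head is quantified innermost, so it takes index 0, in front of the
    tail.\<close>
  have *: "(\<exists>x. length x = Suc n \<and> Q e x) \<longleftrightarrow> (\<exists>y. length y = n \<and> (\<exists>a. Q e (a # y)))" for e
    by (auto simp: length_Suc_conv)
  have "dpred M (\<lambda>e. \<exists>y. length y = n \<and> (\<exists>a. Q e (a # y)))"
  proof (rule Suc.IH, rule dpred_ex)
    have "map (\<lambda>i. e (Suc i)) [0..<n] = map e [Suc 0..<Suc n]" for e :: "nat \<Rightarrow> 'c"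
      by (simp add: map_Suc_upt[symmetric] comp_def del: upt_Suc)
    then have "e 0 # map (\<lambda>i. e (Suc i)) [0..<n] = map e [0..<Suc n]" for e :: "nat \<Rightarrow> 'c"
      by (simp add: upt_conv_Cons del: upt_Suc)
    then show "dpred M (\<lambda>e. Q (\<lambda>i. e (Suc (i + n))) (e 0 # map (\<lambda>i. e (Suc i)) [0..<n]))"
      using Suc.prems by simp
  qed
  then show ?case by (simp only: *)
qed

lemma dpred_all_list:
  assumes "dpred M (\<lambda>e. Q (\<lambda>i. e (i + n)) (map e [0..<n]))"
  shows "dpred M (\<lambda>e. \<forall>x. length x = n \<longrightarrow> Q e x)"
  using dpred_neg[OF dpred_ex_list[of M "\<lambda>e x. \<not> Q e x" n]] dpred_neg[OF assms] by simp

section \<open>Passage between definable sets and definable predicates\<close>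

lemma dpred_mem:
  assumes "definable_dim M n A" "dlist t"
  shows "dpred M (\<lambda>e. t e \<in> A)"
proof -
  obtain p c where p: "wf_fm M p"
    and A: "A = {xs. length xs = n \<and> sat M (\<lambda>i. if i < n then xs ! i else c (i - n)) p}"
    using assms(1) by (auto simp: definable_dim_def)
  obtain ts where ts: "t = (\<lambda>e. map (\<lambda>f. f e) ts)" using assms(2) by (auto simp: dlist_def)
  show ?thesis
  proof (cases "length ts = n")
    case True
    let ?s = "\<lambda>i e. if i < n then t e ! i else c (i - n)"
    have "dterm (?s i)" for i
      by (cases "i < n") (simp_all add: dterm_nth assms(2) dterm_const)
    then show ?thesis unfolding dpred_def A
      by (intro exI[of _ p] exI[of _ ?s]) (use p ts True in auto)
  next
    case False
    then show ?thesis by (simp add: A ts dpred_const)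
  qed
qed

lemma definable_dim_length: "definable_dim M n A \<Longrightarrow> x \<in> A \<Longrightarrow> length x = n"
  by (auto simp: definable_dim_def)

text \<open>The renaming \<open>f\<close> restores the layout of \<open>definable_dim\<close>: a
  variable reading a coordinate \<open>j < n\<close> becomes \<open>j\<close>, and any other
  variable \<open>i\<close> becomes the parameter variable \<open>n + i\<close>.\<close>

lemma definable_dimI:
  assumes "dpred M (\<lambda>e. P (map e [0..<n]))"
  shows "definable_dim M n {xs. length xs = n \<and> P xs}"
proof -
  obtain p s where p: "wf_fm M p" "\<And>i. dterm (s i)"
    "\<And>e. P (map e [0..<n]) \<longleftrightarrow> sat M (\<lambda>i. s i e) p"
    using assms unfolding dpred_def by metis
  define f where "f i = (if \<exists>j<n. s i = (\<lambda>e. e j) then SOME j. j < n \<and> s i = (\<lambda>e. e j) else n + i)" for i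
  \<comment> \<open>Coordinates from \<open>n\<close> on cannot influence
    \<open>P (map e [0..<n])\<close>, so they are frozen at \<open>undefined\<close>; a constant
    term returns its own value.\<close>
  define c where "c i = s i (\<lambda>_. undefined)" for i
  let ?e = "\<lambda>xs i. if i < n then xs ! i else c (i - n)"
  let ?g = "\<lambda>xs i. if i < n then xs ! i else undefined"
  have f1: "f i < n \<and> s i = (\<lambda>e. e (f i))" if "\<exists>j<n. s i = (\<lambda>e. e j)" for i
    using someI_ex[of "\<lambda>j. j < n \<and> s i = (\<lambda>e. e j)"] that by (simp add: f_def)
  have f2: "f i = n + i" if "\<not> (\<exists>j<n. s i = (\<lambda>e. e j))" for i
    using that unfolding f_def by (rule if_not_P)
  have "s i (?g xs) = ?e xs (f i)" for xs i
  proof (cases "\<exists>j<n. s i = (\<lambda>e. e j)")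
    case True
    have "s i (?g xs) = ?g xs (f i)"
      by (subst conjunct2[OF f1[OF True]]) (rule refl)
    then show ?thesis using f1[OF True] by simp
  next
    case False
    from p(2)[of i] consider j where "s i = (\<lambda>e. e j)" | d where "s i = (\<lambda>e. d)"
      unfolding dterm_def by blast
    then show ?thesis
    proof cases
      case (1 j)
      then have "n \<le> j" using False not_le by blast
      then show ?thesis by (simp add: 1 c_def f2[OF False])
    next
      case 2
      then show ?thesis by (simp add: c_def f2[OF False])
    qed
  qed
  then have sat_f: "sat M (\<lambda>i. s i (?g xs)) p \<longleftrightarrow> sat M (?e xs) (ren_fm f p)" for xs by simp
  have map_g: "map (?g xs) [0..<n] = xs" if "length xs = n" for xs
    using that by (auto intro: nth_equalityI)
  have "P xs \<longleftrightarrow> sat M (?e xs) (ren_fm f p)" if "length xs = n" for xs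
    using p(3)[of "?g xs"] unfolding map_g[OF that] sat_f .
  then show ?thesis unfolding definable_dim_def
    by (intro exI[of _ "ren_fm f p"] exI[of _ c]) (use p(1) in auto)
qed

lemmas dintros = dterm_var dterm_const dterm_nth dlist_Nil dlist_Cons dlist_append dlist_take dlist_drop
  dlist_vars dlist_const
  dpred_neg dpred_conj dpred_disj dpred_imp dpred_iff dpred_less dpred_eq dpred_le dpred_ex dpred_all
  dpred_ex_list dpred_all_list

section \<open>Definable subsets of the line\<close>

lemma dpred_subst1:
  assumes "dpred M (\<lambda>e. P (e 0))" "dterm t"
  shows "dpred M (\<lambda>e. P (t e))"
  using dpred_subst[OF assms(1), of "\<lambda>_. t"] assms(2) by simp

lemma dpred_subst2:
  assumes "dpred M (\<lambda>e. P (e 0) (e 1))" "dterm t" "dterm u"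
  shows "dpred M (\<lambda>e. P (t e) (u e))"
proof -
  have "dterm (if i = 0 then t else u)" for i :: nat
    using assms(2,3) by simp
  from dpred_subst[OF assms(1), of "\<lambda>i. if i = 0 then t else u", OF this] show ?thesis
    by simp
qed

text \<open>On an order without endpoints this is the topological boundary for the order topology.
  Writing it with order quantifiers makes it definable, uniformly in a definable family.\<close>

definition bdry :: "'a::linorder set \<Rightarrow> 'a set" where
  "bdry S = {b. \<forall>u v. u < b \<longrightarrow> b < v \<longrightarrow>
    (\<exists>x. u < x \<and> x < v \<and> x \<in> S) \<and> (\<exists>x. u < x \<and> x < v \<and> x \<notin> S)}"

lemma bdry_Compl [simp]: "bdry (- S) = bdry S"
  by (auto simp: bdry_def)

lemma bdryD:
  "b \<in> bdry S \<Longrightarrow> u < b \<Longrightarrow> b < v \<Longrightarrow> \<exists>x. u < x \<and> x < v \<and> x \<in> S"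
  "b \<in> bdry S \<Longrightarrow> u < b \<Longrightarrow> b < v \<Longrightarrow> \<exists>x. u < x \<and> x < v \<and> x \<notin> S"
  by (auto simp: bdry_def)

lemma not_bdryD:
  fixes S :: "'a::unbounded_dense_linorder set"
  assumes "b \<notin> bdry S"
  shows "\<exists>u v. u < b \<and> b < v \<and> ({u<..<v} \<subseteq> S \<or> {u<..<v} \<inter> S = {})"
proof -
  obtain u v where uv: "u < b" "b < v"
    "(\<forall>x. u < x \<longrightarrow> x < v \<longrightarrow> x \<notin> S) \<or> (\<forall>x. u < x \<longrightarrow> x < v \<longrightarrow> x \<in> S)"
    using assms unfolding bdry_def by auto
  from uv(3) have "{u<..<v} \<subseteq> S \<or> {u<..<v} \<inter> S = {}" by auto
  then show ?thesis using uv by blast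
qed

lemma not_bdryI: "u < b \<Longrightarrow> b < v \<Longrightarrow> {u<..<v} \<subseteq> S \<or> {u<..<v} \<inter> S = {} \<Longrightarrow> b \<notin> bdry S"
  by (auto simp: bdry_def) (meson disjoint_iff greaterThanLessThan_iff subset_iff)+

lemma bdry_Un: "bdry (S \<union> T) \<subseteq> bdry S \<union> bdry (T :: 'a::unbounded_dense_linorder set)"
proof -
  have "b \<notin> bdry (S \<union> T)" if bS: "b \<notin> bdry S" and bT: "b \<notin> bdry T" for b
  proof -
    obtain u v where 1: "u < b" "b < v" "{u<..<v} \<subseteq> S \<or> {u<..<v} \<inter> S = {}"
      using not_bdryD[OF bS] by blast
    obtain u' v' where 2: "u' < b" "b < v'" "{u'<..<v'} \<subseteq> T \<or> {u'<..<v'} \<inter> T = {}"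
      using not_bdryD[OF bT] by blast
    have "{max u u'<..<min v v'} \<subseteq> S \<union> T \<or> {max u u'<..<min v v'} \<inter> (S \<union> T) = {}"
      using 1(3) 2(3) by (auto simp: subset_iff disjoint_iff)
    then show ?thesis using 1 2 not_bdryI[of "max u u'" b "min v v'"] by simp
  qed
  then show ?thesis by auto
qed

text \<open>A ray has at most its endpoint as boundary point. Points and bounded intervals arise
  from rays by complements and intersections, which create no new boundary points.\<close>

lemma finite_bdry_point_or_interval:
  fixes I :: "'a::unbounded_dense_linorder set"
  assumes "point_or_interval I"
  shows "finite (bdry I)"
proof -
  have ray: "bdry {a<..} \<subseteq> {a}" for a :: 'a
  proof
    fix b assume b: "b \<in> bdry {a<..}"
    obtain l u where lu: "l < b" "b < u" using lt_ex gt_ex by blast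
    show "b \<in> {a}"
    proof (cases b a rule: linorder_cases)
      case less
      then show ?thesis using b not_bdryI[of l b a "{a<..}"] lu by force
    next
      case greater
      then show ?thesis using b not_bdryI[of a b u "{a<..}"] lu by force
    qed simp
  qed
  have ray': "bdry {..<a} \<subseteq> {a}" for a :: 'a
  proof
    fix b assume b: "b \<in> bdry {..<a}"
    obtain l u where lu: "l < b" "b < u" using lt_ex gt_ex by blast
    show "b \<in> {a}"
    proof (cases b a rule: linorder_cases)
      case less
      then show ?thesis using b not_bdryI[of l b a "{..<a}"] lu by force
    next
      case greater
      then show ?thesis using b not_bdryI[of a b u "{..<a}"] lu by force
    qed simp
  qed
  have Int: "finite (bdry (S \<inter> T))" if "finite (bdry S)" "finite (bdry T)" for S T :: "'a set"
  proof -
    have "bdry (S \<inter> T) = bdry (- S \<union> - T)" by (metis bdry_Compl Compl_Int)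
    also have "\<dots> \<subseteq> bdry S \<union> bdry T" using bdry_Un[of "- S" "- T"] by simp
    finally show ?thesis using that finite_subset by blast
  qed
  have ge: "finite (bdry {a<..})" and le: "finite (bdry {..<a})" for a :: 'a
    using finite_subset[OF ray] finite_subset[OF ray'] by simp_all
  have "{a} = - {a<..} \<inter> - {..<a}" for a :: 'a by auto
  then have pt: "finite (bdry {a})" for a :: 'a
    by (metis Int bdry_Compl ge le)
  have oo: "finite (bdry {a<..<b})" for a b :: 'a
    unfolding greaterThanLessThan_def by (rule Int[OF ge le])
  have "bdry (UNIV :: 'a set) = {}" 
    using bdryD(2)[of _ UNIV] lt_ex gt_ex by (metis UNIV_I equals0I)
  then show ?thesis using assms pt oo ge le by (auto simp: point_or_interval_def)
qed

lemma inf_point_or_interval: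
  fixes I :: "'a::unbounded_dense_linorder set"
  assumes "point_or_interval I" "I \<noteq> {}" "\<forall>x\<in>I. l \<le> x"
  shows "\<exists>b. (\<forall>x\<in>I. b \<le> x) \<and> (\<forall>u>b. \<exists>x\<in>I. x < u)"
proof -
  consider a where "I = {a}" | a b where "I = {a<..<b}" | a where "I = {a<..}"
    | a where "I = {..<a}" | "I = UNIV"
    using assms(1) unfolding point_or_interval_def by blast
  then show ?thesis
  proof cases
    case (2 a b)
    then have "a < b" using assms(2) by (simp add: not_le)
    then have "\<forall>u>a. \<exists>x\<in>I. x < u"
      using dense[of a "min b _"] 2 by (metis min_less_iff_conj greaterThanLessThan_iff)
    then show ?thesis using 2 by (intro exI[of _ a]) auto
  next
    case (3 a)
    then show ?thesis using dense by (intro exI[of _ a]) force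
  next
    case (4 a)
    obtain x where "x < min l a" using lt_ex by blast
    then show ?thesis using assms(3) 4 by force
  next
    case 5
    obtain x where "x < l" using lt_ex by blast
    then show ?thesis using assms(3) 5 by force
  qed auto
qed

lemma inf_Union:
  fixes C :: "'a::linorder set set"
  assumes "finite C" "\<Union>C \<noteq> {}"
    "\<And>I. I \<in> C \<Longrightarrow> I \<noteq> {} \<Longrightarrow> \<exists>b. (\<forall>x\<in>I. b \<le> x) \<and> (\<forall>u>b. \<exists>x\<in>I. x < u)"
  shows "\<exists>b. (\<forall>x\<in>\<Union>C. b \<le> x) \<and> (\<forall>u>b. \<exists>x\<in>\<Union>C. x < u)"
proof -
  define C' where "C' = C - {{}}"
  have C': "finite C'" "C' \<noteq> {}" "\<Union>C' = \<Union>C" using assms(1,2) by (auto simp: C'_def)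
  obtain f where f: "\<And>I. I \<in> C' \<Longrightarrow> (\<forall>x\<in>I. f I \<le> x) \<and> (\<forall>u>f I. \<exists>x\<in>I. x < u)"
    using assms(3) unfolding C'_def by (metis DiffE insertCI)
  let ?b = "Min (f ` C')"
  have "\<forall>x\<in>\<Union>C'. ?b \<le> x"
    using C' f by (meson Min_le UnionE finite_imageI imageI order_trans)
  moreover have "?b \<in> f ` C'" using C' by simp
  then have "\<forall>u>?b. \<exists>x\<in>\<Union>C'. x < u" using f by (metis UnionI imageE)
  ultimately show ?thesis unfolding C' by blast
qed

section \<open>Consequences of o-minimality on the line\<close>

locale o_minimal_structure =
  fixes M :: "('f, 'r, 'a::unbounded_dense_linorder) fo_structure"
  assumes omin: "o_minimal M"
begin

lemma finite_union_of_intervals: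
  assumes "dpred M (\<lambda>e. e 0 \<in> S)"
  shows "\<exists>C. finite C \<and> (\<forall>I\<in>C. point_or_interval I) \<and> S = \<Union>C"
proof -
  have "definable_dim M 1 {xs. length xs = 1 \<and> xs ! 0 \<in> S}"
    by (rule definable_dimI) (use assms in simp)
  then have "\<exists>C. finite C \<and> (\<forall>I\<in>C. point_or_interval I)
      \<and> {x. [x] \<in> {xs. length xs = 1 \<and> xs ! 0 \<in> S}} = \<Union>C"
    using omin unfolding o_minimal_def by blast
  then show ?thesis by simp
qed

lemma finite_bdry:
  assumes "dpred M (\<lambda>e. e 0 \<in> S)"
  shows "finite (bdry S)"
proof -
  obtain C where C: "finite C" "\<forall>I\<in>C. point_or_interval I" "S = \<Union>C"
    using finite_union_of_intervals[OF assms] by blast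
  have "finite (bdry (\<Union>C))" using C(1,2)
  proof (induction C)
    case empty
    \<comment> \<open>A degenerate interval represents the empty union.\<close>
    have "point_or_interval {undefined :: 'a<..<undefined}"
      unfolding point_or_interval_def by blast
    from finite_bdry_point_or_interval[OF this] show ?case by simp
  next
    case (insert I C)
    then have "finite (bdry I)" "finite (bdry (\<Union>C))"
      using finite_bdry_point_or_interval by auto
    then show ?case using bdry_Un[of I "\<Union>C"] finite_subset by fastforce
  qed
  then show ?thesis using C(3) by simp
qed

text \<open>The order need not be complete; the infimum exists because \<open>S\<close> is a finite
  union of points and intervals whose endpoints belong to the structure.\<close>

lemma ex_inf:
  assumes "dpred M (\<lambda>e. e 0 \<in> S)" "S \<noteq> {}" "\<forall>x\<in>S. l \<le> x"
  shows "\<exists>b. (\<forall>x\<in>S. b \<le> x) \<and> (\<forall>u>b. \<exists>x\<in>S. x < u)"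
proof -
  obtain C where C: "finite C" "\<forall>I\<in>C. point_or_interval I" "S = \<Union>C"
    using finite_union_of_intervals[OF assms(1)] by blast
  show ?thesis unfolding C(3)
  proof (rule inf_Union[OF C(1)])
    show "\<Union>C \<noteq> {}" using assms(2) C(3) by simp
  next
    fix I assume "I \<in> C" "I \<noteq> {}"
    moreover from this have "\<forall>x\<in>I. l \<le> x" using assms(3) C(3) by blast
    ultimately show "\<exists>b. (\<forall>x\<in>I. b \<le> x) \<and> (\<forall>u>b. \<exists>x\<in>I. x < u)"
      using inf_point_or_interval C(2) by blast
  qed
qed

text \<open>The infimum of the part of the complement to the right of \<open>x\<close> is such a
  boundary point: between \<open>x\<close> and it everything lies in \<open>S\<close>, while points
  of the complement lie at it or arbitrarily close above it.\<close>

lemma bdry_between_aux: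
  assumes S: "dpred M (\<lambda>e. e 0 \<in> S)" and xy: "x \<in> S" "y \<notin> S" "x < y"
  shows "\<exists>b\<in>bdry S. x \<le> b \<and> b \<le> y"
proof -
  let ?T = "{t. x \<le> t \<and> t \<notin> S}"
  have "dpred M (\<lambda>e. e 0 \<in> ?T)"
    unfolding mem_Collect_eq by (intro dintros dpred_subst1[OF S])
  moreover have "y \<in> ?T" "\<forall>t\<in>?T. x \<le> t" using xy by auto
  ultimately obtain b where b: "\<forall>t\<in>?T. b \<le> t" "\<forall>u>b. \<exists>t\<in>?T. t < u"
    using ex_inf[of ?T x] by blast
  have xb: "x \<le> b" 
  proof (rule ccontr)
    assume "\<not> x \<le> b"
    then obtain t where "t \<in> ?T" "t < x" using b(2) not_le by blast
    then show False by (simp add: leD)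
  qed
  have "b \<le> y" using b(1) xy by auto
  moreover have "b \<in> bdry S"
  proof -
    have "(\<exists>z. u < z \<and> z < v \<and> z \<in> S) \<and> (\<exists>z. u < z \<and> z < v \<and> z \<notin> S)" if uv: "u < b" "b < v" for u v
    proof
      show "\<exists>z. u < z \<and> z < v \<and> z \<notin> S"
        using b uv by (metis (mono_tags, lifting) mem_Collect_eq less_le_trans)
      show "\<exists>z. u < z \<and> z < v \<and> z \<in> S"
      proof (cases "x = b")
        case True
        then show ?thesis using uv xy by auto
      next
        case False
        then have "max u x < b" using uv xb by auto
        then obtain z where z: "max u x < z" "z < b" using dense by blast
        then have "x \<le> z" "\<not> b \<le> z" by auto
        then have "z \<in> S" using b(1) by blast
        then show ?thesis using z uv by (intro exI[of _ z]) auto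
      qed
    qed
    then show ?thesis by (simp add: bdry_def)
  qed
  ultimately show ?thesis using xb by blast
qed

lemma bdry_between:
  assumes S: "dpred M (\<lambda>e. e 0 \<in> S)" and xy: "x \<le> y" "(x \<in> S) \<noteq> (y \<in> S)"
  shows "\<exists>b\<in>bdry S. x \<le> b \<and> b \<le> y"
proof (cases "x \<in> S")
  case True
  then show ?thesis using bdry_between_aux[OF S] xy by (metis le_less)
next
  case False
  have "dpred M (\<lambda>e. e 0 \<in> - S)"
    unfolding Compl_iff by (intro dintros S)
  from bdry_between_aux[OF this, of x y] show ?thesis using xy False by (auto simp: le_less)
qed

text \<open>Only finitely many points of \<open>S\<close> are boundary points, and any other point
  of \<open>S\<close> has a neighbourhood inside \<open>S\<close>.\<close>

lemma infinite_contains_interval: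
  assumes S: "dpred M (\<lambda>e. e 0 \<in> S)" "infinite S"
  obtains u v where "u < v" "{u<..<v} \<subseteq> S"
proof -
  have "infinite (S - bdry S)" using S finite_bdry by simp
  then obtain b where "b \<in> S" "b \<notin> bdry S" by (metis DiffE finite.emptyI equals0I)
  then obtain u v where "u < b" "b < v" "{u<..<v} \<subseteq> S \<or> {u<..<v} \<inter> S = {}"
    using not_bdryD[of b S] by blast
  then show ?thesis using \<open>b \<in> S\<close> that[of u v] by force
qed

lemma infinite_pred_contains_interval:
  assumes "dpred M (\<lambda>e. P (e 0))" "infinite {x. P x}"
  shows "\<exists>u v. u < v \<and> (\<forall>x. u < x \<longrightarrow> x < v \<longrightarrow> P x)"
proof -
  have "dpred M (\<lambda>e. e 0 \<in> {x. P x})" using assms(1) by simp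
  from infinite_contains_interval[OF this assms(2)] obtain u v
    where "u < v" "{u<..<v} \<subseteq> {x. P x}" .
  then show ?thesis by (intro exI[of _ u] exI[of _ v]) auto
qed

text \<open>O-minimality makes infinitude first-order: a definable subset of the line is infinite
  iff it contains an interval with distinct endpoints.\<close>

lemma dpred_infinite:
  assumes Q: "dpred M (\<lambda>e. Q (\<lambda>i. e (Suc i)) (e 0))"
  shows "dpred M (\<lambda>e. infinite {d. Q e d})"
proof -
  have "infinite {d. Q e d} \<longleftrightarrow> (\<exists>u v. u < v \<and> (\<forall>d. u < d \<longrightarrow> d < v \<longrightarrow> Q e d))" for e
  proof
    assume inf: "infinite {d. Q e d}"
    have "dterm (\<lambda>e'. case_nat (e' 0) e i)" for i
      by (cases i) (simp_all add: dterm_var dterm_const)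
    from dpred_subst[OF Q, of "\<lambda>i e'. case_nat (e' 0) e i", OF this]
    have "dpred M (\<lambda>e'. Q e (e' 0))" by simp
    from infinite_pred_contains_interval[OF this inf]
    show "\<exists>u v. u < v \<and> (\<forall>d. u < d \<longrightarrow> d < v \<longrightarrow> Q e d)" .
  next
    assume "\<exists>u v. u < v \<and> (\<forall>d. u < d \<longrightarrow> d < v \<longrightarrow> Q e d)"
    then obtain u v where "u < v" "\<forall>d. u < d \<longrightarrow> d < v \<longrightarrow> Q e d" by blast
    then have "{u<..<v} \<subseteq> {d. Q e d}" by auto
    then show "infinite {d. Q e d}" using infinite_Ioo[OF \<open>u < v\<close>] infinite_super by blast
  qed
  \<comment> \<open>Under the three quantifiers \<open>d\<close>, \<open>v\<close>, \<open>u\<close>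
    have indices 0, 1, 2, so the parameters of \<open>Q\<close> start at index 3.\<close>
  moreover have "dterm (\<lambda>e :: nat \<Rightarrow> 'a. case_nat (e 0) (\<lambda>i. e (Suc (Suc (Suc i)))) i)" for i
    by (cases i) (simp_all add: dterm_var)
  from dpred_subst[OF Q, of "\<lambda>i e. case_nat (e 0) (\<lambda>i. e (Suc (Suc (Suc i)))) i", OF this]
  have "dpred M (\<lambda>e. Q (\<lambda>i. e (Suc (Suc (Suc i)))) (e 0))" by simp
  ultimately show ?thesis by (simp only:) (intro dintros)
qed

text \<open>The fibres of \<open>cls B\<close> are the points of \<open>B\<close> and the components of its complement, so a
  definable set whose boundary lies in \<open>B\<close> is a union of fibres.\<close>

definition cls :: "'a set \<Rightarrow> 'a \<Rightarrow> 'a set \<times> 'a set" where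
  "cls B x = ({b\<in>B. b < x}, {b\<in>B. b \<le> x})"

lemma cls_in: "cls B x \<in> Pow B \<times> Pow B"
  by (auto simp: cls_def)

text \<open>If membership changed, some boundary point between \<open>x\<close> and \<open>y\<close>
  would separate them; lying in \<open>B\<close>, it would be recorded by \<open>cls B\<close>.
  Boundary points elsewhere are unrestricted.\<close>

lemma cls_eqD:
  assumes "dpred M (\<lambda>e. e 0 \<in> S)" "bdry S \<inter> {min x y..max x y} \<subseteq> B" "cls B x = cls B y"
  shows "x \<in> S \<longleftrightarrow> y \<in> S"
proof -
  have *: "x \<in> S \<longleftrightarrow> y \<in> S" if sub: "bdry S \<inter> {x..y} \<subseteq> B" and eq: "cls B x = cls B y" and "x \<le> y" for x y
  proof (rule ccontr)
    assume "(x \<in> S) \<noteq> (y \<in> S)"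
    then have "x < y" and "\<exists>b\<in>bdry S. x \<le> b \<and> b \<le> y"
      using bdry_between[OF assms(1), of x y] \<open>x \<le> y\<close> by (auto simp: le_less)
    then obtain b where b: "b \<in> bdry S" "x \<le> b" "b \<le> y" by blast
    have "b \<in> B" using sub b by auto
    have "{b\<in>B. b < x} = {b\<in>B. b < y}" "{b\<in>B. b \<le> x} = {b\<in>B. b \<le> y}"
      using eq by (simp_all add: cls_def)
    with \<open>b \<in> B\<close> have "b < x \<longleftrightarrow> b < y" "b \<le> x \<longleftrightarrow> b \<le> y" by blast+
    then show False using b \<open>x < y\<close> by auto
  qed
  show ?thesis
  proof (cases "x \<le> y")
    case True
    then show ?thesis using *[of x y] assms by simp
  next
    case False
    then show ?thesis using *[of y x] assms by simp
  qed
qed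

end

section \<open>Definable subsets of the plane\<close>

context o_minimal_structure
begin

text \<open>Here \<open>a\<close> is a record if some member of the family has \<open>a\<close> as its least element in the
  interval. If all members are finite, then records accumulate at \<open>u\<close>, hence fill an interval.\<close>

lemma infinite_member_of_chain:
  assumes T: "dpred M (\<lambda>e. T (e 0) (e 1))" and "u < v"
    and cover: "\<And>a. u < a \<Longrightarrow> a < v \<Longrightarrow> \<exists>i. T i a"
    and chain: "\<And>i a. T i a \<Longrightarrow> u < a \<Longrightarrow> a < v \<Longrightarrow>
      \<exists>w>a. \<forall>a' j. a < a' \<longrightarrow> a' < w \<longrightarrow> T j a' \<longrightarrow> \<not> T j a \<longrightarrow> T i a'"
  shows "\<exists>i. infinite {a. u < a \<and> a < v \<and> T i a}"
proof (rule ccontr)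
  assume "\<not> ?thesis"
  then have fin: "finite {a. u < a \<and> a < v \<and> T i a}" for i by blast
  define R where "R a \<longleftrightarrow> u < a \<and> a < v \<and> (\<exists>i. T i a \<and> (\<forall>b. u < b \<and> b < a \<longrightarrow> \<not> T i b))" for a
  have R: "dpred M (\<lambda>e. R (e 0))"
    unfolding R_def by (intro dintros dpred_subst2[OF T])
  have low: "\<exists>r. R r \<and> r \<le> a" if a: "u < a" "a < v" for a
  proof -
    obtain i where i: "T i a" using cover a by blast
    let ?F = "{b. u < b \<and> b < v \<and> T i b}"
    have "Min ?F \<in> ?F" using fin a i by (intro Min_in) auto
    moreover have "Min ?F \<le> b" if "b \<in> ?F" for b using fin that by (intro Min_le)
    moreover define m where "m = Min ?F"
    ultimately have m: "m \<in> ?F" "\<And>b. b \<in> ?F \<Longrightarrow> m \<le> b" by auto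
    have "\<not> T i b" if "u < b" "b < m" for b
      using m(2)[of b] m(1) that less_trans[of b m v] by auto
    then have "R m" "m \<le> a" unfolding R_def using m a i by auto
    then show ?thesis by blast
  qed
  \<comment> \<open>A least record is impossible: applying \<open>low\<close> to a point between
    \<open>u\<close> and it would give a smaller one.\<close>
  have "infinite {r. R r}"
  proof
    assume f: "finite {r. R r}"
    obtain a where "u < a" "a < v" using dense \<open>u < v\<close> by blast
    then have "{r. R r} \<noteq> {}" using low by blast
    with f have "Min {r. R r} \<in> {r. R r}" by (rule Min_in)
    then have m: "u < Min {r. R r}" "Min {r. R r} < v" by (auto simp: R_def)
    then obtain b where b: "u < b" "b < Min {r. R r}" using dense by blast
    then obtain r where "R r" "r \<le> b" using low[of b] m less_trans by blast
    then have "Min {r. R r} \<le> b" using Min_le[OF f] by fastforce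
    then show False using b by simp
  qed
  from infinite_pred_contains_interval[OF R this] obtain p q
    where pq: "p < q" "\<forall>x. p < x \<longrightarrow> x < q \<longrightarrow> R x" by blast
  obtain a where a: "p < a" "a < q" using dense pq by blast
  then have "R a" using pq by blast
  then obtain i where i: "T i a" "u < a" "a < v" by (auto simp: R_def)
  obtain w where w: "w > a" "\<forall>a' j. a < a' \<longrightarrow> a' < w \<longrightarrow> T j a' \<longrightarrow> \<not> T j a \<longrightarrow> T i a'"
    using chain[OF i] by blast
  \<comment> \<open>Each point here is a record of some member that misses \<open>a\<close>, so the
    chain condition puts all of these points into the single member \<open>i\<close>.\<close>
  have "{a<..<min w q} \<subseteq> {b. u < b \<and> b < v \<and> T i b}"
  proof
    fix b assume b: "b \<in> {a<..<min w q}"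
    then have "R b" using pq a by auto
    then obtain j where j: "T j b" "u < b" "b < v" "\<forall>c. u < c \<and> c < b \<longrightarrow> \<not> T j c"
      by (auto simp: R_def)
    then have "\<not> T j a" using b i by auto
    then have "T i b" using w(2) b j(1) by auto
    then show "b \<in> {b. u < b \<and> b < v \<and> T i b}" using j by simp
  qed
  from finite_subset[OF this fin] show False using infinite_Ioo[of a "min w q"] w(1) a by simp
qed

text \<open>Let \<open>U\<close> be the union of the interiors of the sets \<open>V a\<close>. By
  disjointness a component of \<open>U\<close> lies within a single \<open>V a\<close>, and
  \<open>U\<close> has finitely many components, since its boundary is finite. Each infinite
  \<open>V a\<close> has an interior point \<open>f a\<close>, whose component determines
  \<open>a\<close>.\<close>

lemma finite_infinite_disjoint:
  assumes V: "dpred M (\<lambda>e. V (e 0) (e 1))"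
    and disj: "\<And>a a' d. V a d \<Longrightarrow> V a' d \<Longrightarrow> a = a'"
  shows "finite {a. infinite {d. V a d}}"
proof -
  define N where "N a d \<longleftrightarrow> (\<exists>u v. u < d \<and> d < v \<and> (\<forall>x. u < x \<and> x < v \<longrightarrow> V a x))" for a d
  define U where "U d \<longleftrightarrow> (\<exists>a. N a d)" for d
  have VN: "V a d" if "N a d" for a d using that by (auto simp: N_def)
  have U: "dpred M (\<lambda>e. e 0 \<in> {d. U d})"
    unfolding mem_Collect_eq U_def N_def by (intro dintros dpred_subst2[OF V])
  have Va: "dpred M (\<lambda>e. e 0 \<in> {d. V a d})" for a
    unfolding mem_Collect_eq by (intro dintros dpred_subst2[OF V])
  define B where "B = bdry {d. U d}"
  have "finite B" unfolding B_def by (rule finite_bdry[OF U])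
  have ex: "\<exists>d. N a d" if "infinite {d. V a d}" for a
  proof -
    obtain u v where uv: "u < v" "{u<..<v} \<subseteq> {d. V a d}"
      using infinite_contains_interval[OF Va \<open>infinite _\<close>] .
    then obtain d where "u < d" "d < v" using dense by blast
    then have "N a d" unfolding N_def using uv by (intro exI[of _ u] exI[of _ v]) auto
    then show ?thesis by blast
  qed
  then obtain f where f: "\<And>a. infinite {d. V a d} \<Longrightarrow> N a (f a)" by metis
  \<comment> \<open>An interior point of one set cannot be approached by another, by disjointness,
    nor by the complement of its own set.\<close>
  have nb: "d \<notin> bdry {d. V a d}" if "U d" for a d
  proof
    assume b: "d \<in> bdry {d. V a d}"
    obtain a' u v where *: "u < d" "d < v" "\<forall>x. u < x \<and> x < v \<longrightarrow> V a' x"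
      using \<open>U d\<close> unfolding U_def N_def by blast
    obtain x where "u < x" "x < v" "V a x" using bdryD(1)[OF b *(1,2)] by blast
    then have "a' = a" using *(3) disj by blast
    then show False using bdryD(2)[OF b *(1,2)] *(3) by blast
  qed
  have "inj_on (\<lambda>a. cls B (f a)) {a. infinite {d. V a d}}"
  proof (rule inj_onI)
    fix a a' assume a: "a \<in> {a. infinite {d. V a d}}" "a' \<in> {a. infinite {d. V a d}}"
      and eq: "cls B (f a) = cls B (f a')"
    have N: "N a (f a)" "N a' (f a')" using a f by auto
    then have Uf: "U (f a)" by (auto simp: U_def)
    \<comment> \<open>Points between \<open>f a\<close> and \<open>f a'\<close> outside
      \<open>B\<close> share their class, so they lie in \<open>U\<close>; hence no boundary point
      of \<open>V a\<close> in this range lies outside \<open>B\<close>.\<close>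
    have "U x" if x: "min (f a) (f a') \<le> x" "x \<le> max (f a) (f a')" "x \<notin> B" for x
    proof -
      have "{b\<in>B. b < x} = {b\<in>B. b < f a} \<and> {b\<in>B. b \<le> x} = {b\<in>B. b \<le> f a}"
      proof -
        have "b < x \<longleftrightarrow> b < f a" "b \<le> x \<longleftrightarrow> b \<le> f a" if "b \<in> B" for b
        proof -
          have "b < f a \<longleftrightarrow> b < f a'" "b \<le> f a \<longleftrightarrow> b \<le> f a'"
            using eq that unfolding cls_def by blast+
          then show "b < x \<longleftrightarrow> b < f a" "b \<le> x \<longleftrightarrow> b \<le> f a"
            using x that by (auto simp: min_def max_def split: if_splits)
        qed
        then show ?thesis by blast
      qed
      then have "cls B x = cls B (f a)" by (simp add: cls_def)
      then show ?thesis using cls_eqD[OF U, of x "f a" B] Uf by (auto simp: B_def)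
    qed
    then have "bdry {d. V a d} \<inter> {min (f a) (f a')..max (f a) (f a')} \<subseteq> B"
      using nb by (metis IntE atLeastAtMost_iff subsetI)
    from cls_eqD[OF Va this eq] have "V a (f a')" using VN N(1) by simp
    then show "a = a'" using VN[OF N(2)] disj by blast
  qed
  moreover have "(\<lambda>a. cls B (f a)) ` {a. infinite {d. V a d}} \<subseteq> Pow B \<times> Pow B"
    using cls_in by blast
  moreover have "finite (Pow B \<times> Pow B)" using \<open>finite B\<close> by simp
  ultimately show ?thesis by (rule inj_on_finite)
qed

text \<open>Otherwise all sets \<open>{a. A a d}\<close> are finite. Let \<open>V r a\<close> consist of those \<open>d\<close> in the fibre over \<open>a\<close>
  that are in no fibre strictly between \<open>a\<close> and \<open>r\<close>. The chain lemma, applied first over a fixed \<open>a\<close>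
  and then along the line, gives one \<open>r\<close> for which infinitely many \<open>V r a\<close> are infinite; but for
  fixed \<open>r\<close> these sets are pairwise disjoint.\<close>

lemma infinite_section_exchange:
  assumes A: "dpred M (\<lambda>e. A (e 0) (e 1))" and inf: "infinite {a. infinite {d. A a d}}"
  shows "\<exists>d. infinite {a. A a d}"
proof (rule ccontr)
  assume "\<not> ?thesis"
  then have fin: "finite {a. A a d}" for d by blast
  have "dpred M (\<lambda>e. infinite {d. A (e 0) d})"
    by (intro dpred_infinite dpred_subst2[OF A] dintros)
  from infinite_pred_contains_interval[OF this inf]
  obtain u v where uv: "u < v" "\<forall>a. u < a \<longrightarrow> a < v \<longrightarrow> infinite {d. A a d}" by blast
  define V where "V r a d \<longleftrightarrow> a < r \<and> A a d \<and> (\<forall>b. a < b \<and> b < r \<longrightarrow> \<not> A b d)" for r a d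
  have Vdef: "dpred M (\<lambda>e. V (t e) (s e) (w e))" if "dterm t" "dterm s" "dterm w" for t s w
  proof -
    have "dpred M (\<lambda>e. V (e 0) (e 1) (e 2))"
      unfolding V_def by (intro dintros dpred_subst2[OF A])
    from dpred_subst[OF this, of "\<lambda>i. if i = 0 then t else if i = 1 then s else w"] that
    show ?thesis by simp
  qed
  have Vinf: "\<exists>r. infinite {d. V r a d}" if a: "u < a" "a < v" for a
  proof -
    have "dpred M (\<lambda>e. A a (e 0))" by (intro dpred_subst2[OF A] dintros)
    moreover have "infinite {d. A a d}" using uv a by blast
    ultimately obtain p q where pq: "p < q" "\<forall>d. p < d \<longrightarrow> d < q \<longrightarrow> A a d"
      using infinite_pred_contains_interval[of "A a"] by blast
    have "\<exists>r. infinite {d. p < d \<and> d < q \<and> V r a d}"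
    proof (rule infinite_member_of_chain[OF _ pq(1)])
      show "dpred M (\<lambda>e. V (e 0) a (e 1))" by (intro Vdef dintros)
    next
      fix d assume d: "p < d" "d < q"
      obtain w where "w > a" using gt_ex by blast
      \<comment> \<open>Only finitely many \<open>b\<close> satisfy \<open>A b d\<close>, so the
        bound can be chosen not beyond the first of them after \<open>a\<close>; \<open>w\<close>
        keeps the set nonempty.\<close>
      let ?F = "insert w {b. a < b \<and> A b d}"
      have F: "finite ?F" using finite_subset[OF _ fin[of d], of "{b. a < b \<and> A b d}"] by auto
      have "a < Min ?F" using F \<open>w > a\<close> by (subst Min_gr_iff) auto
      moreover have "\<not> A b d" if "a < b" "b < Min ?F" for b
        using Min_le[OF F, of b] that by auto
      ultimately have "V (Min ?F) a d" using pq d by (auto simp: V_def)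
      then show "\<exists>r. V r a d" by blast
    next
      fix r d assume V: "V r a d"
      have "V r a d'" if "V s a d'" "\<not> V s a d" for s d'
      proof -
        \<comment> \<open>While it stays above \<open>a\<close>, a smaller bound gives a larger set.
          A set missing \<open>d\<close> therefore has a larger bound than \<open>r\<close> and is
          contained in \<open>V r a\<close>.\<close>
        have "r < s" using V that by (force simp: V_def)
        then show ?thesis using V that by (auto simp: V_def)
      qed
      then show "\<exists>w>d. \<forall>d' s. d < d' \<longrightarrow> d' < w \<longrightarrow> V s a d' \<longrightarrow> \<not> V s a d \<longrightarrow> V r a d'"
        using gt_ex by blast
    qed
    then obtain r where "infinite {d. p < d \<and> d < q \<and> V r a d}" by blast
    then have "infinite {d. V r a d}"
      by (rule contrapos_nn) (auto elim: rev_finite_subset)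
    then show ?thesis by blast
  qed
  have Vmono: "V s a d" if "V r a d" "a < s" "s \<le> r" for r s a d
    using that by (auto simp: V_def)
  have "\<exists>r. infinite {a. u < a \<and> a < v \<and> infinite {d. V r a d}}"
  proof (rule infinite_member_of_chain[OF _ uv(1)])
    show "dpred M (\<lambda>e. infinite {d. V (e 0) (e 1) d})"
      by (intro dpred_infinite Vdef dintros)
  next
    fix a assume "u < a" "a < v"
    then show "\<exists>r. infinite {d. V r a d}" by (rule Vinf)
  next
    fix r a assume ra: "infinite {d. V r a d}"
    then have "a < r" by (rule contrapos_np) (simp add: V_def)
    have "infinite {d. V r b d}"
      if "a < b" "b < r" "infinite {d. V s b d}" "\<not> infinite {d. V s a d}" for b s
    proof -
      have "b < s" using that(3) by (rule contrapos_np) (simp add: V_def)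
      have "r < s"
      proof (rule ccontr)
        assume "\<not> r < s"
        then have "{d. V r a d} \<subseteq> {d. V s a d}" using Vmono that(1) \<open>b < s\<close> by force
        then show False using ra that(4) finite_subset by blast
      qed
      then have "{d. V s b d} \<subseteq> {d. V r b d}" using Vmono that(2) by force
      then show ?thesis using that(3) finite_subset by blast
    qed
    then show "\<exists>w>a. \<forall>b s. a < b \<longrightarrow> b < w \<longrightarrow> infinite {d. V s b d} \<longrightarrow>
        \<not> infinite {d. V s a d} \<longrightarrow> infinite {d. V r b d}"
      using \<open>a < r\<close> by blast
  qed
  then obtain r where r: "infinite {a. u < a \<and> a < v \<and> infinite {d. V r a d}}" by blast
  have "finite {a. infinite {d. V r a d}}"
  proof (rule finite_infinite_disjoint)
    show "dpred M (\<lambda>e. V r (e 0) (e 1))" by (intro Vdef dintros)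
    \<comment> \<open>\<open>V r a d\<close> says that \<open>a\<close> is the last point before
      \<open>r\<close> with \<open>A a d\<close>, so \<open>d\<close> determines
      \<open>a\<close>.\<close>
    show "a = a'" if "V r a d" "V r a' d" for a a' d
      using that by (cases a a' rule: linorder_cases) (auto simp: V_def)
  qed
  then have "finite {a. u < a \<and> a < v \<and> infinite {d. V r a d}}"
    by (rule rev_finite_subset) auto
  with r show False by (rule notE)
qed

text \<open>Passing to the interiors \<open>N a\<close> of the fibres, the exchange lemma yields one
  height \<open>d\<close> interior to infinitely many fibres. Such fibres contain intervals starting
  at \<open>d\<close>, and the chain lemma finds a common upper end \<open>s\<close> for infinitely
  many \<open>a\<close>. The box lies directly above height \<open>d\<close>.\<close>

lemma contains_box:
  assumes A: "dpred M (\<lambda>e. A (e 0) (e 1))" and inf: "infinite {a. infinite {d. A a d}}"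
  shows "\<exists>p q r s. p < q \<and> r < s \<and> (\<forall>a d. p < a \<longrightarrow> a < q \<longrightarrow> r < d \<longrightarrow> d < s \<longrightarrow> A a d)"
proof -
  define N where "N a d \<longleftrightarrow> (\<exists>u v. u < d \<and> d < v \<and> (\<forall>x. u < x \<and> x < v \<longrightarrow> A a x))" for a d
  have N: "dpred M (\<lambda>e. N (e 0) (e 1))"
    unfolding N_def by (intro dintros dpred_subst2[OF A])
  have "infinite {d. N a d}" if inf_a: "infinite {d. A a d}" for a
  proof -
    have "dpred M (\<lambda>e. A a (e 0))" by (intro dpred_subst2[OF A] dintros)
    from infinite_pred_contains_interval[OF this inf_a]
    obtain u v where uv: "u < v" "\<forall>d. u < d \<longrightarrow> d < v \<longrightarrow> A a d" by blast
    then have "{u<..<v} \<subseteq> {d. N a d}" unfolding N_def by fastforce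
    then show ?thesis using infinite_Ioo[OF uv(1)] infinite_super by blast
  qed
  then have "{a. infinite {d. A a d}} \<subseteq> {a. infinite {d. N a d}}" by blast
  from infinite_super[OF this inf] have "infinite {a. infinite {d. N a d}}" .
  from infinite_section_exchange[OF N this] obtain d where d: "infinite {a. N a d}" by blast
  have "dpred M (\<lambda>e. N (e 0) d)" by (intro dpred_subst2[OF N] dintros)
  from infinite_pred_contains_interval[OF this d]
  obtain u v where uv: "u < v" "\<forall>a. u < a \<longrightarrow> a < v \<longrightarrow> N a d" by blast
  define T where "T s a \<longleftrightarrow> d < s \<and> (\<forall>x. d < x \<and> x < s \<longrightarrow> A a x)" for s a
  have T: "dpred M (\<lambda>e. T (e 0) (e 1))"
    unfolding T_def by (intro dintros dpred_subst2[OF A])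
  have "\<exists>s. infinite {a. u < a \<and> a < v \<and> T s a}"
  proof (rule infinite_member_of_chain[OF T uv(1)])
    fix a assume "u < a" "a < v"
    then have "N a d" using uv by blast
    then show "\<exists>s. T s a" unfolding N_def T_def by (meson less_trans)
  next
    fix s a assume "T s a"
    have "T s b" if "T t b" "\<not> T t a" for t b
    proof -
      have "s < t" using \<open>T s a\<close> that by (force simp: T_def)
      then show ?thesis using \<open>T s a\<close> that by (auto simp: T_def)
    qed
    then show "\<exists>w>a. \<forall>b t. a < b \<longrightarrow> b < w \<longrightarrow> T t b \<longrightarrow> \<not> T t a \<longrightarrow> T s b"
      using gt_ex by blast
  qed
  then obtain s where s: "infinite {a. u < a \<and> a < v \<and> T s a}" by blast
  have "dpred M (\<lambda>e. u < e 0 \<and> e 0 < v \<and> T s (e 0))"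
    by (intro dintros dpred_subst2[OF T])
  from infinite_pred_contains_interval[OF this s]
  obtain p q where pq: "p < q" "\<forall>a. p < a \<longrightarrow> a < q \<longrightarrow> u < a \<and> a < v \<and> T s a" by blast
  obtain a where "p < a" "a < q" using dense pq by blast
  then have "d < s" using pq by (auto simp: T_def)
  then show ?thesis using pq by (intro exI[of _ p] exI[of _ q] exI[of _ d] exI[of _ s])
      (auto simp: T_def)
qed

end

section \<open>Definable families\<close>

lemma dpred_bex:
  assumes "definable_dim M n A" "dpred M (\<lambda>e. Q (\<lambda>i. e (i + n)) (map e [0..<n]))"
  shows "dpred M (\<lambda>e. \<exists>x\<in>A. Q e x)"
proof -
  have "(\<exists>x\<in>A. Q e x) \<longleftrightarrow> (\<exists>x. length x = n \<and> x \<in> A \<and> Q e x)" for e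
    using definable_dim_length[OF assms(1)] by blast
  then show ?thesis
    by (simp only:) (intro dintros dpred_mem[OF assms(1)] assms(2))
qed

lemma definable_dim_CollectI:
  assumes "\<And>x. x \<in> X \<Longrightarrow> length x = n" "dpred M (\<lambda>e. map e [0..<n] \<in> X)"
  shows "definable_dim M n X"
proof -
  have "X = {x. length x = n \<and> x \<in> X}" using assms(1) by blast
  then show ?thesis using definable_dimI[OF assms(2)] by simp
qed

definition sec :: "'a list set \<Rightarrow> 'a list \<Rightarrow> 'a list set" where
  "sec D x = {y. x @ y \<in> D}"

text \<open>The graph of a partial function from \<open>P\<close> to the line, with the value
  appended to the argument.\<close>

definition functional_over :: "'a list set \<Rightarrow> 'a list set \<Rightarrow> bool" where
  "functional_over P F \<longleftrightarrow> (\<forall>z\<in>F. \<exists>x\<in>P. \<exists>c. z = x @ [c]) \<and>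
    (\<forall>x c d. x @ [c] \<in> F \<longrightarrow> x @ [d] \<in> F \<longrightarrow> c = d)"

definition vals :: "'a list set \<Rightarrow> 'a set" where
  "vals F = {c. \<exists>x. x @ [c] \<in> F}"

lemma finite_image_factor:
  assumes "finite (f ` P)" "\<And>x y. x \<in> P \<Longrightarrow> y \<in> P \<Longrightarrow> f x = f y \<Longrightarrow> g x = g y"
  shows "finite (g ` P)"
proof -
  have "g ` P \<subseteq> (\<lambda>c. g (SOME x. x \<in> P \<and> f x = c)) ` (f ` P)"
  proof
    fix z assume "z \<in> g ` P"
    then obtain x where x: "x \<in> P" "z = g x" by blast
    let ?y = "SOME y. y \<in> P \<and> f y = f x"
    have "?y \<in> P \<and> f ?y = f x" by (rule someI[of _ x]) (use x in simp)
    then have "z = g ?y" using assms(2) x by metis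
    then show "z \<in> (\<lambda>c. g (SOME x. x \<in> P \<and> f x = c)) ` (f ` P)" using x(1) by blast
  qed
  then show ?thesis using assms(1) finite_surj by blast
qed

lemma definable_dim_append:
  assumes A: "definable_dim M a A" and B: "definable_dim M b B"
  shows "definable_dim M (a + b) {x @ y | x y. x \<in> A \<and> y \<in> B}"
proof -
  have "{x @ y | x y. x \<in> A \<and> y \<in> B} = {z. length z = a + b \<and> take a z \<in> A \<and> drop a z \<in> B}"
  proof (intro Set.set_eqI iffI)
    fix z assume "z \<in> {z. length z = a + b \<and> take a z \<in> A \<and> drop a z \<in> B}"
    then show "z \<in> {x @ y | x y. x \<in> A \<and> y \<in> B}"
      using append_take_drop_id[of a z] by (metis (mono_tags, lifting) mem_Collect_eq)
  qed (use definable_dim_length[OF A] definable_dim_length[OF B] in auto)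
  then show ?thesis
    by (simp only:) (intro definable_dimI dintros dpred_mem[OF A] dpred_mem[OF B])
qed

context o_minimal_structure
begin

text \<open>Were the boundary points of all members finite in number, each member would be a union
  of finitely many fixed classes of \<open>cls\<close>, leaving finitely many members. So these
  points fill an interval \<open>(u, v)\<close>, and the function sends \<open>x\<close> to the
  least boundary point of its member there.\<close>

lemma definable_bdry_point:
  assumes P: "definable_dim M p P" and E: "definable_dim M (Suc p) E"
    and inf: "infinite ((\<lambda>x. {c. x @ [c] \<in> E}) ` P)"
    and W: "dpred M (\<lambda>e. e 0 \<in> W)" and EW: "\<And>x c. x @ [c] \<in> E \<Longrightarrow> c \<in> W"
  shows "\<exists>F. definable_dim M (Suc p) F \<and> functional_over P F \<and> infinite (vals F) \<and> vals F \<subseteq> W"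
proof -
  define S where "S x = {c. x @ [c] \<in> E}" for x
  have S: "dpred M (\<lambda>e. e 0 \<in> S x)" for x
    unfolding S_def mem_Collect_eq by (intro dpred_mem[OF E] dintros)
  have bS: "dpred M (\<lambda>e. e i \<in> bdry (S (map (\<lambda>k. e (f k)) [0..<p])))" for i f
    unfolding bdry_def S_def mem_Collect_eq by (intro dintros dpred_mem[OF E])
  define Q where "Q b \<longleftrightarrow> (\<exists>x\<in>P. b \<in> bdry (S x))" for b
  have Q: "dpred M (\<lambda>e. Q (e 0))"
    unfolding Q_def by (intro dpred_bex[OF P] bS dintros)
  have bW: "dpred M (\<lambda>e. e 0 \<in> bdry W)"
    unfolding bdry_def mem_Collect_eq by (intro dintros dpred_subst1[OF W])
  have "infinite {b. Q b}"
  proof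
    assume fin: "finite {b. Q b}"
    have "finite ((\<lambda>x. {cls {b. Q b} c | c. c \<in> S x}) ` P)"
    proof (rule finite_subset)
      show "(\<lambda>x. {cls {b. Q b} c | c. c \<in> S x}) ` P \<subseteq> Pow (Pow {b. Q b} \<times> Pow {b. Q b})"
        by (intro image_subsetI PowI) (use cls_in in blast)
      show "finite (Pow (Pow {b. Q b} \<times> Pow {b. Q b}))" using fin by simp
    qed
    then have "finite (S ` P)"
    proof (rule finite_image_factor)
      fix x y assume xy: "x \<in> P" "y \<in> P"
        and eq: "{cls {b. Q b} c | c. c \<in> S x} = {cls {b. Q b} c | c. c \<in> S y}"
      have *: "S x \<subseteq> S y" if "y \<in> P"
        and eq: "{cls {b. Q b} c | c. c \<in> S x} = {cls {b. Q b} c | c. c \<in> S y}" for x y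
      proof
        fix c assume "c \<in> S x"
        then obtain d where "d \<in> S y" "cls {b. Q b} c = cls {b. Q b} d" using eq by blast
        moreover have "bdry (S y) \<subseteq> {b. Q b}" using \<open>y \<in> P\<close> by (auto simp: Q_def)
        ultimately show "c \<in> S y" using cls_eqD[OF S, of y c d "{b. Q b}"] by blast
      qed
      show "S x = S y" using *[OF xy(2) eq] *[OF xy(1) eq[symmetric]] by blast
    qed
    then show False using inf unfolding S_def by simp
  qed
  \<comment> \<open>Avoiding the finite boundary of \<open>W\<close> will force the values of the
    function into \<open>W\<close>.\<close>
  then have "infinite {b. Q b \<and> b \<notin> bdry W}"
    using Diff_infinite_finite[OF finite_bdry[OF W], of "{b. Q b}"] by (simp add: set_diff_eq)
  moreover have "dpred M (\<lambda>e. Q (e 0) \<and> e 0 \<notin> bdry W)" by (intro dintros Q bW)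
  ultimately obtain u v where uv: "u < v" "\<forall>b. u < b \<longrightarrow> b < v \<longrightarrow> Q b \<and> b \<notin> bdry W"
    using infinite_pred_contains_interval[of "\<lambda>b. Q b \<and> b \<notin> bdry W"] by blast
  define R where "R x c \<longleftrightarrow> u < c \<and> c < v \<and> c \<in> bdry (S x) \<and> (\<forall>d. u < d \<and> d < c \<longrightarrow> d \<notin> bdry (S x))"
    for x c
  define F where "F = {x @ [c] | x c. x \<in> P \<and> R x c}"
  have mem_F: "x @ [c] \<in> F \<longleftrightarrow> x \<in> P \<and> R x c" for x c
    by (auto simp: F_def)
  have lenP: "x \<in> P \<Longrightarrow> length x = p" for x using P by (rule definable_dim_length)
  have "definable_dim M (Suc p) F"
  proof (rule definable_dim_CollectI)
    show "length z = Suc p" if "z \<in> F" for z using that lenP by (auto simp: F_def)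
    have "dpred M (\<lambda>e. map e [0..<p] \<in> P \<and> R (map e [0..<p]) (e p))"
      unfolding R_def by (intro dintros bS dpred_mem[OF P])
    then show "dpred M (\<lambda>e. map e [0..<Suc p] \<in> F)" by (simp add: mem_F)
  qed
  moreover have "functional_over P F"
    unfolding functional_over_def mem_F
  proof (intro conjI allI impI)
    show "\<forall>z\<in>F. \<exists>x\<in>P. \<exists>c. z = x @ [c]" by (auto simp: F_def)
    show "c = d" if "x \<in> P \<and> R x c" "x \<in> P \<and> R x d" for x c d
      using that unfolding R_def by (metis linorder_neq_iff)
  qed
  \<comment> \<open>Values accumulate at \<open>u\<close>: any \<open>b\<close> in the interval is a
    boundary point of some member, whose least one is at most \<open>b\<close>.\<close>
  moreover have "infinite (vals F)"
  proof
    assume f: "finite (vals F)"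
    have m: "u < Min (insert v (vals F))"
      using f uv by (subst Min_gr_iff) (auto simp: vals_def mem_F R_def)
    then obtain b where b: "u < b" "b < Min (insert v (vals F))" using dense by blast
    then have "b < v" using f by auto
    then obtain x where x: "x \<in> P" "b \<in> bdry (S x)" using uv b by (auto simp: Q_def)
    let ?B = "{c \<in> bdry (S x). u < c \<and> c < v}"
    have fB: "finite ?B" using finite_bdry[OF S] by simp
    have "b \<in> ?B" using x b \<open>b < v\<close> by simp
    then have "?B \<noteq> {}" by blast
    with fB have c: "Min ?B \<in> ?B" by (rule Min_in)
    have c': "Min ?B \<le> b" by (rule Min_le) fact+
    have "d \<notin> bdry (S x)" if "u < d" "d < Min ?B" for d
      using Min_le[OF fB, of d] c that less_trans[of d "Min ?B" v] by auto
    then have "R x (Min ?B)" using c unfolding R_def by blast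
    then have "Min ?B \<in> vals F" using x(1) unfolding vals_def mem_F by blast
    then have "Min (insert v (vals F)) \<le> Min ?B" using f by simp
    then show False using b c' by simp
  qed
  \<comment> \<open>A value is approached by points of a member, hence of \<open>W\<close>; off the
    boundary of \<open>W\<close>, this makes it interior to \<open>W\<close>.\<close>
  moreover have "vals F \<subseteq> W"
  proof
    fix c assume "c \<in> vals F"
    then obtain x where x: "u < c" "c < v" "c \<in> bdry (S x)"
      by (auto simp: vals_def mem_F R_def)
    then have "c \<notin> bdry W" using uv by blast
    from not_bdryD[OF this] obtain p q where pq: "p < c" "c < q"
      "{p<..<q} \<subseteq> W \<or> {p<..<q} \<inter> W = {}" by blast
    obtain d where "p < d" "d < q" "d \<in> S x" using bdryD(1)[OF x(3) pq(1,2)] by blast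
    then have "d \<in> {p<..<q} \<inter> W" using EW by (simp add: S_def)
    then have "{p<..<q} \<subseteq> W" using pq(3) by blast
    then show "c \<in> W" using pq by auto
  qed
  ultimately show ?thesis by blast
qed

text \<open>If for some \<open>t\<close> the fibres over the first coordinate \<open>t\<close> already form an infinite family, drop
  that coordinate. Otherwise consider, for each pair of indices, the set of \<open>t\<close> at which the two
  members differ: were there only finitely many such sets, testing one \<open>t\<close> in each of them would
  distinguish all members.\<close>

lemma definable_function_to_coordinate:
  assumes P: "definable_dim M p P" and "definable_dim M n W" and "definable_dim M (p + n) D"
    and "D \<subseteq> {x @ y | x y. x \<in> P \<and> y \<in> W}" and "infinite (sec D ` P)"
  shows "\<exists>F j. definable_dim M (Suc (p + p)) F \<and>
    functional_over {x @ y | x y. x \<in> P \<and> y \<in> P} F \<and> infinite (vals F) \<and>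
    j < n \<and> vals F \<subseteq> (\<lambda>w. w ! j) ` W"
  using assms(2-)
proof (induction n arbitrary: W D)
  case 0
  have "sec D ` P \<subseteq> {{}, {[]}}"
  proof
    fix S assume "S \<in> sec D ` P"
    then obtain x where x: "x \<in> P" "S = sec D x" by blast
    have "y = []" if "y \<in> S" for y
    proof -
      have "length (x @ y) = p + 0"
        using that x definable_dim_length[OF 0(2)] unfolding sec_def by blast
      then show ?thesis using definable_dim_length[OF P x(1)] by simp
    qed
    then show "S \<in> {{}, {[]}}" by blast
  qed
  then show ?case using 0(4) finite_subset by blast
next
  case (Suc n)
  note D = Suc.prems(2) and W = Suc.prems(1)
  have lenP: "x \<in> P \<Longrightarrow> length x = p" for x using P by (rule definable_dim_length)
  have lenD: "x \<in> P \<Longrightarrow> x @ t # y \<in> D \<Longrightarrow> length y = n" for x t y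
    using definable_dim_length[OF D, of "x @ t # y"] lenP by simp
  have DW: "t # y \<in> W" if "x \<in> P" and xD: "x @ t # y \<in> D" for x t y
  proof -
    obtain x' w where "x @ t # y = x' @ w" "x' \<in> P" "w \<in> W" using xD Suc.prems(3) by blast
    then show ?thesis using lenP \<open>x \<in> P\<close> by simp
  qed
  show ?case
  proof (cases "\<exists>t. infinite ((\<lambda>x. sec D (x @ [t])) ` P)")
    case True
    then obtain t where t: "infinite ((\<lambda>x. sec D (x @ [t])) ` P)" by blast
    define W' where "W' = {y. length y = n \<and> t # y \<in> W}"
    define D' where "D' = {z. length z = p + n \<and> take p z \<in> P \<and> take p z @ t # drop p z \<in> D}"
    have sec_D': "sec D' x = sec D (x @ [t])" if "x \<in> P" for x
      using lenP[OF that] lenD[OF that] that by (auto simp: sec_def D'_def)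
    have "\<exists>F j. definable_dim M (Suc (p + p)) F \<and>
      functional_over {x @ y | x y. x \<in> P \<and> y \<in> P} F \<and> infinite (vals F) \<and>
      j < n \<and> vals F \<subseteq> (\<lambda>w. w ! j) ` W'"
    proof (rule Suc.IH)
      show "definable_dim M n W'"
        unfolding W'_def by (intro definable_dimI dpred_mem[OF W] dintros)
      show "definable_dim M (p + n) D'"
        unfolding D'_def by (intro definable_dimI dpred_mem[OF P] dpred_mem[OF D] dintros)
      show "D' \<subseteq> {x @ y | x y. x \<in> P \<and> y \<in> W'}"
      proof
        fix z assume z: "z \<in> D'"
        then have "t # drop p z \<in> W" using DW[of "take p z"] by (simp add: D'_def)
        then have "z = take p z @ drop p z \<and> take p z \<in> P \<and> drop p z \<in> W'"
          using z by (simp add: D'_def W'_def)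
        then show "z \<in> {x @ y | x y. x \<in> P \<and> y \<in> W'}" by blast
      qed
      show "infinite (sec D' ` P)" using t sec_D' by simp
    qed
    then obtain F j where F: "definable_dim M (Suc (p + p)) F"
      "functional_over {x @ y | x y. x \<in> P \<and> y \<in> P} F" "infinite (vals F)"
      "j < n" "vals F \<subseteq> (\<lambda>w. w ! j) ` W'" by blast
    have "(\<lambda>w. w ! j) ` W' \<subseteq> (\<lambda>w. w ! Suc j) ` W"
    proof (rule image_subsetI)
      fix y assume "y \<in> W'"
      then have "t # y \<in> W" "y ! j = (t # y) ! Suc j" by (auto simp: W'_def)
      then show "y ! j \<in> (\<lambda>w. w ! Suc j) ` W" by blast
    qed
    with F(5) have "vals F \<subseteq> (\<lambda>w. w ! Suc j) ` W" by (rule subset_trans)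
    moreover have "Suc j < Suc n" using F(4) by simp
    ultimately show ?thesis using F(1-3) by blast
  next
    case False
    define PP where "PP = {x @ y | x y. x \<in> P \<and> y \<in> P}"
    have PP: "definable_dim M (p + p) PP" unfolding PP_def by (rule definable_dim_append[OF P P])
    \<comment> \<open>Points of \<open>E\<close> have the form \<open>x @ x' @ [t]\<close>, with
      \<open>t\<close> at index \<open>p + p\<close>; the sections over \<open>x @ x'\<close> are
      the difference sets.\<close>
    define E where "E = {z. length z = Suc (p + p) \<and> take p z \<in> P \<and> take p (drop p z) \<in> P \<and>
      (\<exists>y. length y = n \<and>
        (take p z @ z ! (p + p) # y \<in> D) \<noteq> (take p (drop p z) @ z ! (p + p) # y \<in> D))}"
    have mem_E: "x @ x' @ [t] \<in> E \<longleftrightarrow> sec D (x @ [t]) \<noteq> sec D (x' @ [t])"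
      if "x \<in> P" "x' \<in> P" for x x' t
    proof -
      have len: "length x = p" "length x' = p" using that lenP by auto
      then have "(x @ x' @ [t]) ! (p + p) = t" by (simp add: nth_append)
      then have "x @ x' @ [t] \<in> E \<longleftrightarrow> (\<exists>y. length y = n \<and> (x @ t # y \<in> D) \<noteq> (x' @ t # y \<in> D))"
        using that len by (simp add: E_def)
      also have "\<dots> \<longleftrightarrow> (\<exists>y. (x @ t # y \<in> D) \<noteq> (x' @ t # y \<in> D))"
        using lenD that by blast
      also have "\<dots> \<longleftrightarrow> sec D (x @ [t]) \<noteq> sec D (x' @ [t])"
        unfolding sec_def set_eq_iff by simp
      finally show ?thesis .
    qed
    define W1 where "W1 = {t. \<exists>y. length y = n \<and> t # y \<in> W}"
    have "\<exists>F. definable_dim M (Suc (p + p)) F \<and> functional_over PP F \<and> infinite (vals F) \<and> vals F \<subseteq> W1"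
    proof (rule definable_bdry_point[OF PP])
      show "definable_dim M (Suc (p + p)) E"
        unfolding E_def by (intro definable_dimI dpred_mem[OF P] dpred_mem[OF D] dintros)
      show "dpred M (\<lambda>e. e 0 \<in> W1)"
        unfolding W1_def mem_Collect_eq by (intro dpred_mem[OF W] dintros)
      show "c \<in> W1" if zE: "z @ [c] \<in> E" for z c
      proof -
        have z: "length z = p + p" "take p z \<in> P" "take p (drop p z) \<in> P"
          using zE by (auto simp: E_def)
        then obtain y where "length y = n"
          "take p z @ c # y \<in> D \<or> take p (drop p z) @ c # y \<in> D"
          using zE by (auto simp: E_def nth_append)
        then show ?thesis using DW z unfolding W1_def by blast
      qed
      show "infinite ((\<lambda>z. {c. z @ [c] \<in> E}) ` PP)"
      proof
        assume fin: "finite ((\<lambda>z. {c. z @ [c] \<in> E}) ` PP)"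
        let ?\<D> = "(\<lambda>z. {c. z @ [c] \<in> E}) ` PP - {{}}"
        define T where "T = (\<lambda>S. SOME c. c \<in> S) ` ?\<D>"
        have T: "finite T" using fin by (simp add: T_def)
        \<comment> \<open>Each test value sees only finitely many fibres in this case, so there are
          finitely many tuples of fibres over \<open>T\<close>.\<close>
        have "(\<lambda>x. restrict (\<lambda>t. sec D (x @ [t])) T) ` P \<subseteq>
            (\<Pi>\<^sub>E t\<in>T. (\<lambda>x. sec D (x @ [t])) ` P)"
          by auto
        moreover have "finite (\<Pi>\<^sub>E t\<in>T. (\<lambda>x. sec D (x @ [t])) ` P)"
          using T False by (intro finite_PiE) auto
        ultimately have "finite ((\<lambda>x. restrict (\<lambda>t. sec D (x @ [t])) T) ` P)"
          by (rule finite_subset)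
        then have "finite (sec D ` P)"
        proof (rule finite_image_factor)
          fix x x' assume x: "x \<in> P" "x' \<in> P"
            and eq: "restrict (\<lambda>t. sec D (x @ [t])) T = restrict (\<lambda>t. sec D (x' @ [t])) T"
          have "{c. (x @ x') @ [c] \<in> E} = {}"
          proof (rule ccontr)
            assume ne: "{c. (x @ x') @ [c] \<in> E} \<noteq> {}"
            define t where "t = (SOME c. c \<in> {c. (x @ x') @ [c] \<in> E})"
            have t: "t \<in> {c. (x @ x') @ [c] \<in> E}"
              unfolding t_def using ne by (rule some_in_eq[THEN iffD2])
            have "x @ x' \<in> PP" using x by (auto simp: PP_def)
            then have "{c. (x @ x') @ [c] \<in> E} \<in> ?\<D>" using ne by blast
            then have "t \<in> T" unfolding T_def t_def by (rule imageI)
            then have "sec D (x @ [t]) = sec D (x' @ [t])" using fun_cong[OF eq, of t] by simp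
            then show False using t mem_E[OF x, of t] by simp
          qed
          then have *: "sec D (x @ [c]) = sec D (x' @ [c])" for c
            using mem_E[OF x, of c] by auto
          have "y \<in> sec D x \<longleftrightarrow> y \<in> sec D x'" for y
          proof (cases y)
            \<comment> \<open>The lists in \<open>D\<close> have length \<open>p + Suc n\<close>, so
              the empty list belongs to neither section.\<close>
            case Nil
            then show ?thesis
              using definable_dim_length[OF D] x lenP by (fastforce simp: sec_def)
          next
            case (Cons c w)
            then show ?thesis using *[of c] by (auto simp: sec_def set_eq_iff)
          qed
          then show "sec D x = sec D x'" by blast
        qed
        then show False using Suc.prems(4) by blast
      qed
    qed
    moreover have "W1 \<subseteq> (\<lambda>w. w ! 0) ` W"
    proof
      fix c assume "c \<in> W1"
      then obtain y where "c # y \<in> W" by (auto simp: W1_def)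
      then show "c \<in> (\<lambda>w. w ! 0) ` W" by force
    qed
    ultimately show ?thesis unfolding PP_def by blast
  qed
qed

end

section \<open>Boxes and orthogonality\<close>

lemma infinite_coordinate:
  assumes "infinite S" "\<And>x. x \<in> S \<Longrightarrow> length x = n"
  shows "\<exists>j<n. infinite ((\<lambda>x. x ! j) ` S)"
proof (rule ccontr)
  assume "\<not> ?thesis"
  then have fin: "finite (\<Union>j<n. (\<lambda>x. x ! j) ` S)" by blast
  have "S \<subseteq> {xs. set xs \<subseteq> (\<Union>j<n. (\<lambda>x. x ! j) ` S) \<and> length xs = n}"
    using assms(2) by (fastforce simp: in_set_conv_nth)
  then show False using assms(1) finite_lists_length_eq[OF fin, of n] finite_subset by blast
qed

lemma infinite_pigeonhole:
  assumes "infinite K" "\<And>a. a \<in> K \<Longrightarrow> \<exists>j\<in>B. P j a" "finite B"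
  shows "\<exists>j\<in>B. infinite {a \<in> K. P j a}"
proof (rule ccontr)
  assume "\<not> ?thesis"
  then have "finite (\<Union>j\<in>B. {a \<in> K. P j a})" using assms(3) by blast
  moreover have "K \<subseteq> (\<Union>j\<in>B. {a \<in> K. P j a})" using assms(2) by blast
  ultimately show False using assms(1) finite_subset by blast
qed

lemma nths_single: "k < length xs \<Longrightarrow> nths xs {k} = [xs ! k]"
proof (induction xs arbitrary: k)
  case (Cons x xs)
  show ?case
  proof (cases k)
    case (Suc m)
    then have "{j. Suc j \<in> {k}} = {m}" by auto
    then show ?thesis using Cons Suc by (simp add: nths_Cons)
  qed (simp add: nths_Cons)
qed simp

lemma nths_pair: "i < j \<Longrightarrow> j < length xs \<Longrightarrow> nths xs {i, j} = [xs ! i, xs ! j]"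
proof (induction xs arbitrary: i j)
  case (Cons x xs)
  obtain l where l: "j = Suc l" using Cons.prems by (cases j) auto
  show ?case
  proof (cases i)
    case 0
    then have "{k. Suc k \<in> {i, j}} = {l}" using l by auto
    then show ?thesis using Cons.prems 0 l by (simp add: nths_Cons nths_single)
  next
    case (Suc m)
    then have "{k. Suc k \<in> {i, j}} = {m, l}" using l by auto
    then show ?thesis using Cons l Suc by (simp add: nths_Cons)
  qed
qed simp

lemma open_box_nonempty:
  fixes as bs :: "'a::dense_linorder list"
  assumes "list_all2 (<) as bs"
  shows "open_box as bs \<noteq> {}"
proof -
  have "\<exists>xs. list_all2 (<) as xs \<and> list_all2 (<) xs bs"
    using assms
  proof (induction rule: list_all2_induct)
    case (Cons a as b bs)
    then obtain x xs where "a < x" "x < b" "list_all2 (<) as xs" "list_all2 (<) xs bs"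
      using dense by blast
    then show ?case by (intro exI[of _ "x # xs"]) simp
  qed simp
  then show ?thesis by (auto simp: open_box_def)
qed

lemma no_plane_box:
  fixes X :: "'a::dense_linorder list set"
  assumes "odim X = 1" "\<And>x. x \<in> X \<Longrightarrow> length x = n"
  shows "\<not> contains_open_box 2 ((\<lambda>xs. nths xs J) ` X)"
proof
  let ?K = "{k. \<exists>J. contains_open_box k ((\<lambda>xs. nths xs J) ` X)}"
  assume "contains_open_box 2 ((\<lambda>xs. nths xs J) ` X)"
  then have "2 \<in> ?K" by blast
  \<comment> \<open>Finiteness of \<open>?K\<close> is what makes \<open>Max\<close> in
    \<open>odim\<close> an actual upper bound.\<close>
  have "?K \<subseteq> {..n}"
  proof
    fix k assume "k \<in> ?K"
    then obtain J as bs where box: "length as = k" "list_all2 (<) as bs"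
      "open_box as bs \<subseteq> (\<lambda>xs. nths xs J) ` X"
      unfolding contains_open_box_def by blast
    obtain xs where xs: "xs \<in> open_box as bs" using open_box_nonempty[OF box(2)] by blast
    then obtain x where "x \<in> X" "xs = nths x J" using box(3) by blast
    then have "length xs = card {i. i < n \<and> i \<in> J}" using assms(2) by (simp add: length_nths)
    also have "\<dots> \<le> card {..<n}" by (rule card_mono) auto
    finally have "length xs \<le> n" by simp
    moreover have "length xs = k"
      using xs box(1) by (auto simp: open_box_def dest: list_all2_lengthD)
    ultimately show "k \<in> {..n}" by simp
  qed
  then have "finite ?K" using finite_subset by blast
  then have "2 \<le> odim X" unfolding odim_def using \<open>2 \<in> ?K\<close> by (rule Max_ge)
  then show False using assms(1) by simp
qed

section \<open>Cartesian products and powers\<close>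

lemma cart_prod_Nil [simp]: "cart_prod [] = {[]}"
  by (simp add: cart_prod_def)

lemma cart_prod_Cons [simp]: "cart_prod (X # Xs) = {x @ w | x w. x \<in> X \<and> w \<in> cart_prod Xs}"
  by (auto simp: cart_prod_def set_Cons_def image_iff) (metis concat.simps(2))+

lemma cart_power_0 [simp]: "cart_power X 0 = {[]}"
  by (simp add: cart_power_def)

lemma cart_power_Suc: "cart_power X (Suc k) = {x @ w | x w. x \<in> X \<and> w \<in> cart_power X k}"
  by (simp add: cart_power_def)

lemma cart_power_add: "cart_power X (k + l) = {x @ y | x y. x \<in> cart_power X k \<and> y \<in> cart_power X l}"
proof (induction k)
  case (Suc k)
  show ?case unfolding add_Suc cart_power_Suc Suc
    by (auto; metis append_assoc)
qed simp

lemma cart_power_nth: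
  assumes "\<And>x. x \<in> X \<Longrightarrow> length x = n" "w \<in> cart_power X k" "j < k * n"
  shows "\<exists>u\<in>X. w ! j = u ! (j mod n)"
  using assms(2,3)
proof (induction k arbitrary: w j)
  case (Suc k)
  then obtain x w' where w: "w = x @ w'" "x \<in> X" "w' \<in> cart_power X k"
    by (auto simp: cart_power_Suc)
  show ?case
  proof (cases "j < n")
    case True
    then show ?thesis using w assms(1) by (intro bexI[of _ x]) (simp_all add: nth_append)
  next
    case False
    then have "\<exists>u\<in>X. w' ! (j - n) = u ! ((j - n) mod n)"
      using Suc w by (intro Suc.IH) auto
    moreover have "(j - n) mod n = j mod n" using False by (simp add: le_mod_geq)
    ultimately show ?thesis using False w assms(1) by (simp add: nth_append)
  qed
qed simp

lemma definable_dim_cart_power: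
  assumes "definable_dim M n X"
  shows "definable_dim M (k * n) (cart_power X k)"
proof (induction k)
  case 0
  show ?case by (rule definable_dim_CollectI) (simp_all add: dpred_const)
next
  case (Suc k)
  then show ?case using definable_dim_append[OF assms Suc] by (simp add: cart_power_Suc)
qed

lemma dpred_finite: "finite B \<Longrightarrow> dterm t \<Longrightarrow> dpred M (\<lambda>e. t e \<in> B)"
proof (induction rule: finite_induct)
  case empty
  show ?case by (simp add: dpred_const)
next
  case (insert b B)
  then have "dpred M (\<lambda>e. t e = b \<or> t e \<in> B)" by (intro dintros)
  then show ?case by simp
qed

text \<open>If \<open>D\<close> had finitely many distinct sections, it would be the finite union of
  the boxes whose first factor collects all \<open>x\<close> with a given section \<open>S\<close>
  and whose second factor is \<open>S\<close>.\<close>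

lemma not_orthogonalD:
  fixes M :: "('f, 'r, 'a::linorder) fo_structure"
  assumes X: "definable_dim M a X" and Z: "definable_dim M b Z"
    and "\<not> orthogonal M [X, Z]"
  shows "\<exists>k l D. definable_dim M (k * a + l * b) D \<and>
    D \<subseteq> {x @ y | x y. x \<in> cart_power X k \<and> y \<in> cart_power Z l} \<and>
    infinite (sec D ` cart_power X k)"
proof -
  obtain ks D where ks: "length ks = length [X, Z]" and D: "definable M D"
    "D \<subseteq> cart_prod (map2 cart_power [X, Z] ks)"
    "\<not> (\<exists>\<B>. finite \<B> \<and> (\<forall>B\<in>\<B>. box_for M (map2 cart_power [X, Z] ks) B) \<and> D = \<Union>\<B>)"
    using assms(3) unfolding orthogonal_def not_all not_imp by (elim exE conjE) (rule that)
  obtain k l where kl: "ks = [k, l]" using ks by (auto simp: length_Suc_conv)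
  define P where "P = cart_power X k"
  define Q where "Q = cart_power Z l"
  have P: "definable_dim M (k * a) P" unfolding P_def by (rule definable_dim_cart_power[OF X])
  have Q: "definable_dim M (l * b) Q" unfolding Q_def by (rule definable_dim_cart_power[OF Z])
  note lenP = definable_dim_length[OF P] and lenQ = definable_dim_length[OF Q]
  have DPQ: "D \<subseteq> {x @ y | x y. x \<in> P \<and> y \<in> Q}"
    using D(2) by (auto simp: kl P_def Q_def)
  \<comment> \<open>\<open>definable\<close> leaves the arity open; a point of \<open>D\<close>
    fixes it. The empty set is the union of no boxes.\<close>
  have "D \<noteq> {}" using D(3) spec[of _ "{} :: 'a list set set"] by auto
  then obtain z where z: "z \<in> D" by blast
  obtain N where N: "definable_dim M N D" using D(1) by (auto simp: definable_def)
  have "length z = k * a + l * b" 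
  proof -
    obtain x y where "z = x @ y" "x \<in> P" "y \<in> Q" using z DPQ by blast
    then show ?thesis using lenP lenQ by simp
  qed
  then have DD: "definable_dim M (k * a + l * b) D" using N definable_dim_length[OF N z] by simp
  have "infinite (sec D ` P)"
  proof
    assume fin: "finite (sec D ` P)"
    define box where "box S = {x @ y | x y. x \<in> {x\<in>P. sec D x = S} \<and> y \<in> S}" for S
    have "box_for M [P, Q] (box S)" if S: "S \<in> sec D ` P" for S
    proof -
      obtain x0 where x0: "x0 \<in> P" "S = sec D x0" using S by blast
      have mem: "y \<in> sec D x \<longleftrightarrow> x @ y \<in> D" for x y by (simp add: sec_def)
      have lenS: "length y = l * b" if "x \<in> P" "x @ y \<in> D" for x y
        using definable_dim_length[OF DD that(2)] lenP[OF that(1)] by simp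
      have SQ: "S \<subseteq> Q"
      proof
        fix y assume "y \<in> S"
        then obtain x' y' where "x0 @ y = x' @ y'" "x' \<in> P" "y' \<in> Q"
          using DPQ x0(2) mem by blast
        then show "y \<in> Q" using lenP x0(1) by simp
      qed
      have "definable_dim M (l * b) {y. length y = l * b \<and> x0 @ y \<in> D}"
        by (intro definable_dimI dpred_mem[OF DD] dintros)
      moreover have "S = {y. length y = l * b \<and> x0 @ y \<in> D}"
        using x0 lenS[OF x0(1)] by (auto simp: sec_def)
      ultimately have "definable M S" by (auto simp: definable_def)
      have "definable_dim M (k * a) {x. length x = k * a \<and> (x \<in> P \<and>
          (\<forall>y. length y = l * b \<longrightarrow> (x @ y \<in> D) = (x0 @ y \<in> D)))}"
        by (intro definable_dimI dpred_mem[OF DD] dpred_mem[OF P] dintros)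
      moreover have "{x\<in>P. sec D x = S} = {x. length x = k * a \<and> (x \<in> P \<and>
          (\<forall>y. length y = l * b \<longrightarrow> (x @ y \<in> D) = (x0 @ y \<in> D)))}"
        using lenP lenS x0 unfolding x0(2) sec_def by (auto simp: Set.set_eq_iff)
      ultimately have "definable M {x\<in>P. sec D x = S}" by (auto simp: definable_def)
      then show ?thesis unfolding box_for_def using \<open>definable M S\<close> SQ
        by (intro exI[of _ "[{x\<in>P. sec D x = S}, S]"]) (auto simp: box_def)
    qed
    moreover have "D = \<Union>(box ` sec D ` P)"
    proof (intro Set.set_eqI iffI)
      fix z assume z: "z \<in> D"
      then obtain x y where xy: "z = x @ y" "x \<in> P" using DPQ by blast
      then have "z \<in> box (sec D x)" using z by (auto simp: box_def sec_def)
      then show "z \<in> \<Union>(box ` sec D ` P)" using xy(2) by blast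
    qed (auto simp: box_def sec_def)
    moreover have "finite (box ` sec D ` P)" using fin by simp
    ultimately have "\<exists>\<B>. finite \<B> \<and> (\<forall>B\<in>\<B>. box_for M [P, Q] B) \<and> D = \<Union>\<B>"
      by (intro exI[of _ "box ` sec D ` P"]) simp
    then show False using D(3) by (simp add: kl P_def Q_def)
  qed
  then show ?thesis using DD DPQ unfolding P_def Q_def by blast
qed

text \<open>In a finite union of boxes, the section over \<open>x\<close> is the union of the second
  factors of those boxes whose first factor contains \<open>x\<close>, so it is determined by a
  subset of the finite family.\<close>

lemma orthogonalD:
  assumes X: "definable_dim M a X" and "orthogonal M [X, Y]" "definable M D"
    and DXY: "D \<subseteq> {x @ y | x y. x \<in> cart_power X k \<and> y \<in> cart_power Y l}"
  shows "finite (sec D ` cart_power X k)"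
proof -
  have lenP: "length x = k * a" if "x \<in> cart_power X k" for x
    using definable_dim_length[OF definable_dim_cart_power[OF X] that] .
  have "\<exists>\<B>. finite \<B> \<and> (\<forall>B\<in>\<B>. box_for M (map2 cart_power [X, Y] [k, l]) B) \<and> D = \<Union>\<B>"
    using assms(2,3) DXY unfolding orthogonal_def
    by (elim allE[of _ "[k, l]"] allE[of _ D]) auto
  then obtain \<B> where \<B>: "finite \<B>" "\<And>B. B \<in> \<B> \<Longrightarrow> box_for M [cart_power X k, cart_power Y l] B"
    "D = \<Union>\<B>" by auto
  have "\<exists>U V. U \<subseteq> cart_power X k \<and> B = {x @ y | x y. x \<in> U \<and> y \<in> V}" if B: "B \<in> \<B>" for B
    using \<B>(2)[OF B] unfolding box_for_def by (auto simp: list_all2_Cons2) blast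
  then have "\<forall>B\<in>\<B>. \<exists>U V. U \<subseteq> cart_power X k \<and> B = {x @ y | x y. x \<in> U \<and> y \<in> V}"
    by (intro ballI)
  from bchoice[OF this] obtain U where "\<forall>B\<in>\<B>. \<exists>V. U B \<subseteq> cart_power X k \<and>
      B = {x @ y | x y. x \<in> U B \<and> y \<in> V}" by (rule exE)
  from bchoice[OF this] obtain V where "\<forall>B\<in>\<B>. U B \<subseteq> cart_power X k \<and>
      B = {x @ y | x y. x \<in> U B \<and> y \<in> V B}" by (rule exE)
  note UV = bspec[OF this]
  have U: "U B \<subseteq> cart_power X k" and mem: "z \<in> B \<longleftrightarrow> (\<exists>x y. z = x @ y \<and> x \<in> U B \<and> y \<in> V B)"
    if B: "B \<in> \<B>" for B z
    using conjunct1[OF UV[OF B]] arg_cong[OF conjunct2[OF UV[OF B]], of "\<lambda>S. z \<in> S"]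
    unfolding mem_Collect_eq by - assumption+
  have "sec D ` cart_power X k \<subseteq> (\<lambda>\<C>. \<Union>(V ` \<C>)) ` Pow \<B>"
  proof (rule image_subsetI)
    fix x assume x: "x \<in> cart_power X k"
    have "sec D x = \<Union>(V ` {B\<in>\<B>. x \<in> U B})"
    proof (intro Set.set_eqI iffI)
      fix y assume "y \<in> sec D x"
      then obtain B where B: "B \<in> \<B>" "x @ y \<in> B" using \<B>(3) by (auto simp: sec_def)
      then obtain x' y' where *: "x @ y = x' @ y'" "x' \<in> U B" "y' \<in> V B" using mem[OF B(1)] B(2) by blast
      \<comment> \<open>Equal lengths make the two decompositions of the concatenated point
        agree.\<close>
      then have "length x' = length x" using subsetD[OF U[OF B(1)]] lenP x by simp
      then show "y \<in> \<Union>(V ` {B\<in>\<B>. x \<in> U B})" using * B by auto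
    next
      fix y assume "y \<in> \<Union>(V ` {B\<in>\<B>. x \<in> U B})"
      then obtain B where "B \<in> \<B>" "x \<in> U B" "y \<in> V B" by blast
      then have "x @ y \<in> B" "B \<in> \<B>" using mem by blast+
      then show "y \<in> sec D x" using \<B>(3) by (auto simp: sec_def)
    qed
    then show "sec D x \<in> (\<lambda>\<C>. \<Union>(V ` \<C>)) ` Pow \<B>" by blast
  qed
  from finite_surj[OF _ this] show ?thesis using \<B>(1) by simp
qed

section \<open>One-dimensional groups\<close>

context o_minimal_structure
begin

text \<open>Otherwise one coordinate \<open>j\<close> takes infinitely many values on infinitely
  many of the infinite fibres, and \<open>contains_box\<close> produces a box in the projection to
  coordinates \<open>i\<close> and \<open>j\<close>.\<close>

lemma finite_infinite_fibres:
  assumes C: "definable_dim M n C"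
    and box: "\<And>J. \<not> contains_open_box 2 ((\<lambda>xs. nths xs J) ` C)" and "i < n"
  shows "finite {c. infinite {u\<in>C. u ! i = c}}"
proof (rule ccontr)
  assume inf: "infinite {c. infinite {u\<in>C. u ! i = c}}"
  note lenC = definable_dim_length[OF C]
  have "\<exists>j\<in>{..<n}. infinite {c \<in> {c. infinite {u\<in>C. u ! i = c}}.
      infinite ((\<lambda>u. u ! j) ` {u\<in>C. u ! i = c})}"
  proof (rule infinite_pigeonhole[OF inf])
    fix c assume "c \<in> {c. infinite {u\<in>C. u ! i = c}}"
    then show "\<exists>j\<in>{..<n}. infinite ((\<lambda>u. u ! j) ` {u\<in>C. u ! i = c})"
      using infinite_coordinate[of "{u\<in>C. u ! i = c}" n] lenC by auto
  qed simp
  then obtain j where j: "j < n" and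
    "infinite {c \<in> {c. infinite {u\<in>C. u ! i = c}}. infinite ((\<lambda>u. u ! j) ` {u\<in>C. u ! i = c})}"
    by blast
  then have *: "infinite {c. infinite ((\<lambda>u. u ! j) ` {u\<in>C. u ! i = c})}"
    by (auto elim!: contrapos_nn rev_finite_subset)
  define A where "A c d \<longleftrightarrow> (\<exists>u\<in>C. u ! i = c \<and> u ! j = d)" for c d
  have A: "dpred M (\<lambda>e. A (e 0) (e 1))"
    unfolding A_def by (intro dpred_bex[OF C] dintros)
  have "(\<lambda>u. u ! j) ` {u\<in>C. u ! i = c} = {d. A c d}" for c by (auto simp: A_def)
  with * have "infinite {c. infinite {d. A c d}}" by simp
  from contains_box[OF A this] obtain p q r s where
    pqrs: "p < q" "r < s" "\<forall>a d. p < a \<longrightarrow> a < q \<longrightarrow> r < d \<longrightarrow> d < s \<longrightarrow> A a d" by blast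
  \<comment> \<open>For \<open>i = j\<close> the relation \<open>A\<close> would lie on the
    diagonal, which contains no box.\<close>
  have "i \<noteq> j"
  proof
    assume "i = j"
    obtain a where "p < a" "a < q" using dense[OF pqrs(1)] by blast
    moreover obtain d where "r < d" "d < s" using dense[OF pqrs(2)] by blast
    moreover obtain d' where "d < d'" "d' < s" using dense[OF \<open>d < s\<close>] by blast
    moreover have "r < d'" using \<open>r < d\<close> \<open>d < d'\<close> by (rule less_trans)
    ultimately have "A a d" "A a d'" using pqrs(3) by blast+
    then show False using \<open>i = j\<close> \<open>d < d'\<close> by (auto simp: A_def)
  qed
  have "open_box [p, r] [q, s] \<subseteq> (\<lambda>xs. nths xs {i, j}) ` C" if "i < j"
  proof
    fix xs assume "xs \<in> open_box [p, r] [q, s]"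
    then obtain a d where xs: "xs = [a, d]" "p < a" "a < q" "r < d" "d < s"
      by (auto simp: open_box_def list_all2_Cons1)
    then obtain u where "u \<in> C" "u ! i = a" "u ! j = d" using pqrs(3) by (auto simp: A_def)
    then have "nths u {i, j} = xs" using nths_pair[OF that, of u] lenC j xs by simp
    then show "xs \<in> (\<lambda>xs. nths xs {i, j}) ` C" using \<open>u \<in> C\<close> by blast
  qed
  \<comment> \<open>\<open>nths\<close> keeps coordinates in increasing order, so here the box is
    transposed.\<close>
  moreover have "open_box [r, p] [s, q] \<subseteq> (\<lambda>xs. nths xs {j, i}) ` C" if "j < i"
  proof
    fix xs assume "xs \<in> open_box [r, p] [s, q]"
    then obtain a d where xs: "xs = [d, a]" "p < a" "a < q" "r < d" "d < s"
      by (auto simp: open_box_def list_all2_Cons1)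
    then obtain u where "u \<in> C" "u ! i = a" "u ! j = d" using pqrs(3) by (auto simp: A_def)
    then have "nths u {j, i} = xs" using nths_pair[OF that, of u] lenC \<open>i < n\<close> xs by simp
    then show "xs \<in> (\<lambda>xs. nths xs {j, i}) ` C" using \<open>u \<in> C\<close> by blast
  qed
  ultimately have "\<exists>J as bs. length as = 2 \<and> list_all2 (<) as bs \<and>
      open_box as bs \<subseteq> (\<lambda>xs. nths xs J) ` C"
  proof (cases "i < j")
    case True
    with \<open>i < j \<Longrightarrow> _\<close> show ?thesis using pqrs(1,2)
      by (intro exI[of _ "{i, j}"] exI[of _ "[p, r]"] exI[of _ "[q, s]"]) simp
  next
    case False
    then have "j < i" using \<open>i \<noteq> j\<close> by simp
    with \<open>j < i \<Longrightarrow> _\<close> show ?thesis using pqrs(1,2)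
      by (intro exI[of _ "{j, i}"] exI[of _ "[r, p]"] exI[of _ "[s, q]"]) simp
  qed
  then show False using box unfolding contains_open_box_def by blast
qed

text \<open>Non-orthogonality is converted into a function on a power of \<open>X\<close> whose
  infinitely many values are coordinates of points of \<open>Z\<close> itself: coordinate
  \<open>j\<close> on a power of \<open>Z\<close> is coordinate \<open>j mod n\<close> on one
  factor.\<close>

lemma nonorthogonal_function:
  assumes X: "definable_dim M a X" and Z: "definable_dim M n Z" and "\<not> orthogonal M [X, Z]"
  shows "\<exists>k F i. definable_dim M (Suc (k * a)) F \<and> functional_over (cart_power X k) F \<and>
    infinite (vals F) \<and> i < n \<and> vals F \<subseteq> (\<lambda>u. u ! i) ` Z"
proof -
  obtain k l D where D: "definable_dim M (k * a + l * n) D"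
    "D \<subseteq> {x @ y | x y. x \<in> cart_power X k \<and> y \<in> cart_power Z l}"
    "infinite (sec D ` cart_power X k)"
    using not_orthogonalD[OF X Z assms(3)] by blast
  obtain F j where F: "definable_dim M (Suc (k * a + k * a)) F"
    "functional_over {x @ y | x y. x \<in> cart_power X k \<and> y \<in> cart_power X k} F"
    "infinite (vals F)" "j < l * n" "vals F \<subseteq> (\<lambda>w. w ! j) ` cart_power Z l"
    using definable_function_to_coordinate[OF definable_dim_cart_power[OF X]
      definable_dim_cart_power[OF Z] D] by blast
  have "(\<lambda>w. w ! j) ` cart_power Z l \<subseteq> (\<lambda>u. u ! (j mod n)) ` Z"
  proof (rule image_subsetI)
    fix w assume "w \<in> cart_power Z l"
    then show "w ! j \<in> (\<lambda>u. u ! (j mod n)) ` Z"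
      using cart_power_nth[OF definable_dim_length[OF Z] _ F(4), where w = w] by blast
  qed
  with F(5) have "vals F \<subseteq> (\<lambda>u. u ! (j mod n)) ` Z" by (rule subset_trans)
  moreover have "j mod n < n" using F(4) by (cases n) auto
  moreover have "definable_dim M (Suc ((k + k) * a)) F" using F(1) by (simp add: distrib_right)
  moreover have "functional_over (cart_power X (k + k)) F" using F(2) by (simp add: cart_power_add)
  ultimately show ?thesis using F(3) by blast
qed

lemma dpred_vals:
  assumes F: "definable_dim M (Suc m) F"
  shows "dpred M (\<lambda>e. e i \<in> vals F)"
proof -
  have "vals F = {c. \<exists>x. length x = m \<and> x @ [c] \<in> F}"
    using definable_dim_length[OF F] by (fastforce simp: vals_def)
  then show ?thesis unfolding mem_Collect_eq
    by (simp only: mem_Collect_eq) (intro dintros dpred_mem[OF F])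
qed

end

section \<open>Translations of a one-dimensional definable group\<close>

locale one_dimensional_group = o_minimal_structure M + group G
  for M :: "('f, 'r, 'a::unbounded_dense_linorder) fo_structure"
    and G :: "('a list, 'm) monoid_scheme" (structure) +
  fixes n :: nat
  assumes carrier_dim: "definable_dim M n (carrier G)"
    and mult_dim: "definable_dim M (3 * n)
      {x @ y @ (x \<otimes> y) | x y. x \<in> carrier G \<and> y \<in> carrier G}"
    and odim_carrier: "odim (carrier G) = 1"
begin

lemma length_carrier: "u \<in> carrier G \<Longrightarrow> length u = n"
  by (rule definable_dim_length[OF carrier_dim])

lemma mult_graph:
  assumes "g \<in> carrier G" "v \<in> carrier G" "u \<in> carrier G"
  shows "g @ v @ u \<in> {x @ y @ (x \<otimes> y) | x y. x \<in> carrier G \<and> y \<in> carrier G} \<longleftrightarrow> g \<otimes> v = u"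
proof
  assume "g @ v @ u \<in> {x @ y @ (x \<otimes> y) | x y. x \<in> carrier G \<and> y \<in> carrier G}"
  then obtain x y where "g @ v @ u = x @ y @ (x \<otimes> y)" "x \<in> carrier G" "y \<in> carrier G" by blast
  then show "g \<otimes> v = u" using assms length_carrier by simp
next
  assume "g \<otimes> v = u"
  then show "g @ v @ u \<in> {x @ y @ (x \<otimes> y) | x y. x \<in> carrier G \<and> y \<in> carrier G}"
    using assms by blast
qed

lemma finite_bad:
  "i < n \<Longrightarrow> finite {c. infinite {u \<in> carrier G. u ! i = c}}"
  by (rule finite_infinite_fibres[OF carrier_dim no_plane_box[OF odim_carrier length_carrier]])

text \<open>For fixed \<open>u\<close> over \<open>a\<close>, the infinitely many \<open>v\<close>
  over \<open>J\<close> give distinct elements moving \<open>v\<close> to \<open>u\<close>. Hence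
  infinitely many \<open>g\<close> serve each \<open>a\<close>, and \<open>contains_box\<close>
  applies to pairs of \<open>a\<close> and a coordinate of \<open>g\<close>. A horizontal line
  through the box on which that coordinate has a finite fibre leaves finitely many candidates for
  one common \<open>g\<close>.\<close>

lemma translation_with_infinite_overlap:
  assumes I: "dpred M (\<lambda>e. e 0 \<in> I)" "infinite I" "I \<subseteq> (\<lambda>u. u ! i) ` carrier G"
    and J: "dpred M (\<lambda>e. e 0 \<in> J)" "infinite J" "J \<subseteq> (\<lambda>u. u ! j) ` carrier G"
  shows "\<exists>g\<in>carrier G. infinite {a\<in>I. \<exists>u\<in>carrier G. \<exists>v\<in>carrier G.
    u ! i = a \<and> v ! j \<in> J \<and> g \<otimes> v = u}"
proof -
  let ?\<mu> = "{x @ y @ (x \<otimes> y) | x y. x \<in> carrier G \<and> y \<in> carrier G}"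
  \<comment> \<open>Multiplication enters through its graph, as this is the set assumed
    definable.\<close>
  define R where "R a g \<longleftrightarrow>
    (\<exists>u\<in>carrier G. \<exists>v\<in>carrier G. u ! i = a \<and> v ! j \<in> J \<and> g @ v @ u \<in> ?\<mu>)" for a g
  have R_inf: "infinite {g\<in>carrier G. R a g}" if "a \<in> I" for a
  proof -
    obtain u where u: "u \<in> carrier G" "u ! i = a" using I(3) \<open>a \<in> I\<close> by blast
    let ?V = "{v\<in>carrier G. v ! j \<in> J}"
    have "J \<subseteq> (\<lambda>v. v ! j) ` ?V" using J(3) by blast
    then have "infinite ?V" using J(2) finite_surj by blast
    moreover have "inj_on (\<lambda>v. u \<otimes> inv v) ?V"
      using u(1) by (intro inj_onI) (metis (no_types, lifting) inv_closed inv_inv Units_eq Units_l_cancel mem_Collect_eq)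
    ultimately have "infinite ((\<lambda>v. u \<otimes> inv v) ` ?V)" using finite_imageD by blast
    moreover have "(\<lambda>v. u \<otimes> inv v) ` ?V \<subseteq> {g\<in>carrier G. R a g}"
    proof (rule image_subsetI)
      fix v assume v: "v \<in> ?V"
      then have "u \<otimes> inv v \<in> carrier G" "(u \<otimes> inv v) \<otimes> v = u" using u(1) by (auto simp: m_assoc)
      moreover from this have "(u \<otimes> inv v) @ v @ u \<in> ?\<mu>" using mult_graph v u(1) by blast
      ultimately show "u \<otimes> inv v \<in> {g\<in>carrier G. R a g}" using u v unfolding R_def by blast
    qed
    ultimately show ?thesis using finite_subset by blast
  qed
  have "\<exists>r\<in>{..<n}. infinite {a\<in>I. infinite ((\<lambda>g. g ! r) ` {g\<in>carrier G. R a g})}"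
  proof (rule infinite_pigeonhole[OF I(2)])
    fix a assume "a \<in> I"
    from infinite_coordinate[OF R_inf[OF this], of n]
    show "\<exists>r\<in>{..<n}. infinite ((\<lambda>g. g ! r) ` {g\<in>carrier G. R a g})"
      using length_carrier by auto
  qed simp
  then obtain r where r: "r < n" and
    r_inf: "infinite {a\<in>I. infinite ((\<lambda>g. g ! r) ` {g\<in>carrier G. R a g})}" by blast
  define A where "A a c \<longleftrightarrow> a \<in> I \<and> (\<exists>g\<in>carrier G. R a g \<and> g ! r = c)" for a c
  have A: "dpred M (\<lambda>e. A (e 0) (e 1))"
    unfolding A_def R_def
    by (intro dintros dpred_bex[OF carrier_dim] dpred_mem[OF mult_dim]
        dpred_subst1[OF I(1)] dpred_subst1[OF J(1)])
  have "{a\<in>I. infinite ((\<lambda>g. g ! r) ` {g\<in>carrier G. R a g})} \<subseteq> {a. infinite {c. A a c}}"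
  proof
    fix a assume a: "a \<in> {a\<in>I. infinite ((\<lambda>g. g ! r) ` {g\<in>carrier G. R a g})}"
    then have "(\<lambda>g. g ! r) ` {g\<in>carrier G. R a g} = {c. A a c}" by (auto simp: A_def)
    then show "a \<in> {a. infinite {c. A a c}}" using a by simp
  qed
  from contains_box[OF A infinite_super[OF this r_inf]] obtain p q s t where
    pqst: "p < q" "s < t" "\<forall>a c. p < a \<longrightarrow> a < q \<longrightarrow> s < c \<longrightarrow> c < t \<longrightarrow> A a c" by blast
  \<comment> \<open>Only finitely many heights have infinite fibres, so some height of the box
    avoids them.\<close>
  have "infinite ({s<..<t} - {c. infinite {u \<in> carrier G. u ! r = c}})"
    using infinite_Ioo[OF pqst(2)] finite_bad[OF r] by simp
  from infinite_imp_nonempty[OF this]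
  obtain c where "c \<in> {s<..<t} - {c. infinite {u \<in> carrier G. u ! r = c}}" by blast
  then have c: "s < c" "c < t" "finite {u \<in> carrier G. u ! r = c}" by simp_all
  have "\<exists>g\<in>{g\<in>carrier G. g ! r = c}. infinite {a \<in> {p<..<q}. a \<in> I \<and> R a g}"
  proof (rule infinite_pigeonhole[OF infinite_Ioo[OF pqst(1)] _ c(3)])
    fix a assume "a \<in> {p<..<q}"
    then have "A a c" using pqst(3) c by simp
    then show "\<exists>g\<in>{g\<in>carrier G. g ! r = c}. a \<in> I \<and> R a g" by (auto simp: A_def)
  qed
  then obtain g where g: "g \<in> carrier G" "infinite {a \<in> {p<..<q}. a \<in> I \<and> R a g}" by blast
  have "{a \<in> {p<..<q}. a \<in> I \<and> R a g} \<subseteq> {a\<in>I. \<exists>u\<in>carrier G. \<exists>v\<in>carrier G.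
      u ! i = a \<and> v ! j \<in> J \<and> g \<otimes> v = u}"
    using mult_graph[OF g(1)] unfolding R_def by blast
  from infinite_super[OF this g(2)] show ?thesis using g(1) by blast
qed

text \<open>The correspondence induced by \<open>g\<close> is pulled back along \<open>F\<close> and
  \<open>H\<close> to a set \<open>D\<close>. Orthogonality would give finitely many sections of
  \<open>D\<close>, hence finitely many sets \<open>\<Gamma> a\<close>. These being finite, only
  finitely many values over \<open>J\<close> would occur, each reached from finitely many
  \<open>a\<close>, against the infinite overlap.\<close>

lemma not_orthogonal_trans:
  assumes X: "definable_dim M a X" "\<not> orthogonal M [X, carrier G]"
    and Y: "definable_dim M b Y" "\<not> orthogonal M [Y, carrier G]"
  shows "\<not> orthogonal M [X, Y]"
proof
  assume orth: "orthogonal M [X, Y]"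
  let ?\<mu> = "{x @ y @ (x \<otimes> y) | x y. x \<in> carrier G \<and> y \<in> carrier G}"
  obtain k F i where F: "definable_dim M (Suc (k * a)) F" "functional_over (cart_power X k) F"
    "infinite (vals F)" "i < n" "vals F \<subseteq> (\<lambda>u. u ! i) ` carrier G"
    using nonorthogonal_function[OF X(1) carrier_dim X(2)] by blast
  obtain l H j where H: "definable_dim M (Suc (l * b)) H" "functional_over (cart_power Y l) H"
    "infinite (vals H)" "j < n" "vals H \<subseteq> (\<lambda>u. u ! j) ` carrier G"
    using nonorthogonal_function[OF Y(1) carrier_dim Y(2)] by blast
  \<comment> \<open>Removing values with infinite fibres makes the correspondence finite in both
    directions.\<close>
  define bad where "bad i = {c. infinite {u \<in> carrier G. u ! i = c}}" for i
  have bad: "finite (bad i)" "finite (bad j)"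
    using finite_bad F(4) H(4) by (auto simp: bad_def)
  have "\<exists>g\<in>carrier G. infinite {a\<in>vals F - bad i. \<exists>u\<in>carrier G. \<exists>v\<in>carrier G.
    u ! i = a \<and> v ! j \<in> vals H - bad j \<and> g \<otimes> v = u}"
  proof (rule translation_with_infinite_overlap)
    show "dpred M (\<lambda>e. e 0 \<in> vals F - bad i)" "dpred M (\<lambda>e. e 0 \<in> vals H - bad j)"
      unfolding Diff_iff
      by (intro dintros dpred_vals[OF F(1)] dpred_vals[OF H(1)] dpred_finite bad)+
    show "infinite (vals F - bad i)" "infinite (vals H - bad j)" using F(3) H(3) bad by auto
  qed (use F(5) H(5) in auto)
  then obtain g where g: "g \<in> carrier G" and g_inf:
    "infinite {a\<in>vals F - bad i. \<exists>u\<in>carrier G. \<exists>v\<in>carrier G.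
      u ! i = a \<and> v ! j \<in> vals H - bad j \<and> g \<otimes> v = u}" (is "infinite ?A") by blast
  define D where "D = {z. length z = k * a + l * b \<and> (\<exists>u\<in>carrier G. \<exists>v\<in>carrier G.
    take (k * a) z @ [u ! i] \<in> F \<and> drop (k * a) z @ [v ! j] \<in> H \<and> g @ v @ u \<in> ?\<mu>)}"
  have "definable_dim M (k * a + l * b) D"
    unfolding D_def
    by (intro definable_dimI dpred_bex[OF carrier_dim] dpred_mem[OF mult_dim] dpred_mem[OF F(1)]
        dpred_mem[OF H(1)] dintros)
  then have "definable M D" by (auto simp: definable_def)
  have F_dom: "x \<in> cart_power X k" if "x @ [c] \<in> F" for x c
    using F(2) that unfolding functional_over_def by fastforce
  have H_dom: "y \<in> cart_power Y l" if "y @ [c] \<in> H" for y c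
    using H(2) that unfolding functional_over_def by fastforce
  have F_fun: "c = d" if "x @ [c] \<in> F" "x @ [d] \<in> F" for x c d
    using F(2) that unfolding functional_over_def by blast
  have H_fun: "c = d" if "x @ [c] \<in> H" "x @ [d] \<in> H" for x c d
    using H(2) that unfolding functional_over_def by blast
  have mem_D: "x @ y \<in> D \<longleftrightarrow> (\<exists>u\<in>carrier G. \<exists>v\<in>carrier G.
      x @ [u ! i] \<in> F \<and> y @ [v ! j] \<in> H \<and> g \<otimes> v = u)" if "length x = k * a" for x y
    using that definable_dim_length[OF H(1)] mult_graph[OF g] unfolding D_def
    by fastforce
  have "D \<subseteq> {x @ y | x y. x \<in> cart_power X k \<and> y \<in> cart_power Y l}"
  proof
    fix z assume "z \<in> D"
    then have "take (k * a) z \<in> cart_power X k" "drop (k * a) z \<in> cart_power Y l"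
      using F_dom H_dom by (auto simp: D_def)
    then show "z \<in> {x @ y | x y. x \<in> cart_power X k \<and> y \<in> cart_power Y l}"
      using append_take_drop_id[of "k * a" z] by (metis (mono_tags, lifting) mem_Collect_eq)
  qed
  from orthogonalD[OF X(1) orth \<open>definable M D\<close> this]
  have fin: "finite (sec D ` cart_power X k)" .
  define \<Gamma> where "\<Gamma> a = {c\<in>vals H. \<exists>u\<in>carrier G. \<exists>v\<in>carrier G. u ! i = a \<and> v ! j = c \<and> g \<otimes> v = u}"
    for a
  have "\<Gamma> ` ?A \<subseteq> (\<lambda>S. {c. \<exists>y\<in>S. y @ [c] \<in> H}) ` sec D ` cart_power X k"
  proof (rule image_subsetI)
    fix a' assume "a' \<in> ?A"
    then obtain x where x: "x @ [a'] \<in> F" by (auto simp: vals_def)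
    have len: "length x = k * a" using definable_dim_length[OF F(1) x] by simp
    \<comment> \<open>Since \<open>F\<close> is single-valued, the section over \<open>x\<close>
      depends only on the value \<open>a'\<close>; applying \<open>H\<close> to it returns exactly
      \<open>\<Gamma> a'\<close>.\<close>
    have sec_x: "y \<in> sec D x \<longleftrightarrow> (\<exists>c\<in>\<Gamma> a'. y @ [c] \<in> H)" for y
      unfolding sec_def mem_Collect_eq mem_D[OF len] \<Gamma>_def vals_def using x F_fun by blast
    have "\<Gamma> a' = {c. \<exists>y\<in>sec D x. y @ [c] \<in> H}"
    proof (intro Set.set_eqI iffI)
      fix c assume c: "c \<in> \<Gamma> a'"
      then obtain y where "y @ [c] \<in> H" by (auto simp: \<Gamma>_def vals_def)
      then show "c \<in> {c. \<exists>y\<in>sec D x. y @ [c] \<in> H}" using c sec_x by blast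
    next
      fix c assume "c \<in> {c. \<exists>y\<in>sec D x. y @ [c] \<in> H}"
      then show "c \<in> \<Gamma> a'" using sec_x H_fun by blast
    qed
    then show "\<Gamma> a' \<in> (\<lambda>S. {c. \<exists>y\<in>S. y @ [c] \<in> H}) ` sec D ` cart_power X k"
      using F_dom[OF x] by blast
  qed
  from finite_subset[OF this] have "finite (\<Gamma> ` ?A)" using fin by simp
  \<comment> \<open>As \<open>a'\<close> is not in \<open>bad i\<close>, finitely many
    \<open>u\<close> lie over it, and \<open>g\<close> determines \<open>v\<close> from
    \<open>u\<close>.\<close>
  moreover have "finite (\<Gamma> a')" if "a' \<in> ?A" for a'
  proof (rule finite_subset)
    show "\<Gamma> a' \<subseteq> (\<lambda>u. (inv g \<otimes> u) ! j) ` {u\<in>carrier G. u ! i = a'}"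
    proof
      fix c assume "c \<in> \<Gamma> a'"
      then obtain u v where uv: "u \<in> carrier G" "v \<in> carrier G" "u ! i = a'" "v ! j = c" "g \<otimes> v = u"
        by (auto simp: \<Gamma>_def)
      then have "inv g \<otimes> u = v" using g by (metis inv_solve_left)
      then show "c \<in> (\<lambda>u. (inv g \<otimes> u) ! j) ` {u\<in>carrier G. u ! i = a'}" using uv by blast
    qed
    show "finite ((\<lambda>u. (inv g \<otimes> u) ! j) ` {u\<in>carrier G. u ! i = a'})"
      using that by (auto simp: bad_def)
  qed
  ultimately have fin_U: "finite (\<Union>(\<Gamma> ` ?A))" by blast
  \<comment> \<open>The sets \<open>\<Gamma> a\<close> may meet \<open>bad j\<close>, but a witness
    for membership in \<open>?A\<close> lies outside it; the removal keeps the fibres over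
    \<open>c\<close> finite.\<close>
  have "?A \<subseteq> (\<Union>c\<in>\<Union>(\<Gamma> ` ?A) - bad j. (\<lambda>v. (g \<otimes> v) ! i) ` {v\<in>carrier G. v ! j = c})"
  proof
    fix a' assume a': "a' \<in> ?A"
    then obtain u v where uv: "u \<in> carrier G" "v \<in> carrier G" "u ! i = a'"
      "v ! j \<in> vals H - bad j" "g \<otimes> v = u" by blast
    then have "v ! j \<in> \<Gamma> a'" by (auto simp: \<Gamma>_def)
    then have "v ! j \<in> \<Union>(\<Gamma> ` ?A) - bad j" using a' uv(4) by blast
    then show "a' \<in> (\<Union>c\<in>\<Union>(\<Gamma> ` ?A) - bad j. (\<lambda>v. (g \<otimes> v) ! i) ` {v\<in>carrier G. v ! j = c})"
      using uv by blast
  qed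
  moreover have "finite (\<Union>c\<in>\<Union>(\<Gamma> ` ?A) - bad j. (\<lambda>v. (g \<otimes> v) ! i) ` {v\<in>carrier G. v ! j = c})"
    by (rule finite_UN_I) (use fin_U in \<open>simp_all add: bad_def\<close>)
  ultimately have "finite ?A" by (rule finite_subset)
  with g_inf show False by (rule notE)
qed

end

theorem theorem3p4:
  fixes M :: "('f, 'r, 'a::unbounded_dense_linorder) fo_structure"
    and G :: "('a list, 'm) monoid_scheme"
  assumes "o_minimal M"
    and "definable_group M G"
    and "odim (carrier G) = 1"
  shows "cohesive M (carrier G)"
proof -
  interpret group G using assms(2) by (simp add: definable_group_def)
  obtain n where n: "definable_dim M n (carrier G)"
    using assms(2) by (auto simp: definable_group_def definable_def)
  let ?\<mu> = "{x @ y @ (x \<otimes>\<^bsub>G\<^esub> y) | x y. x \<in> carrier G \<and> y \<in> carrier G}"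
  obtain m where m: "definable_dim M m ?\<mu>"
    using assms(2) by (auto simp: definable_group_def definable_def)
  \<comment> \<open>The triple of units exhibits a point of the graph, which fixes its ambient
    dimension.\<close>
  have "\<one>\<^bsub>G\<^esub> @ \<one>\<^bsub>G\<^esub> @ (\<one>\<^bsub>G\<^esub> \<otimes>\<^bsub>G\<^esub> \<one>\<^bsub>G\<^esub>) \<in> ?\<mu>" by blast
  from definable_dim_length[OF m this] have "m = 3 * n"
    using definable_dim_length[OF n one_closed] by simp
  then interpret one_dimensional_group M G n
    using assms n m by unfold_locales auto
  show ?thesis
    unfolding cohesive_def using assms(2) not_orthogonal_trans
    by (auto simp: definable_group_def definable_def)
qed

end
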